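(* Let $A$ be a principal ideal domain with field of fractions $K$, let $L/K$ be a finite separable field extension of degree $n\ge 2$, let $B$ be the integral closure of $A$ in $L$, and let $\theta\in B$ be such that $L=K(\theta)$. Let $f(x)=x^n+k_{n-1}x^{n-1}+\dots+k_1x+k_0\in A[x]$ be the minimal polynomial of $\theta$ over $K$. Let $\mathfrak{b}$ be an ideal of $A[\theta]$ of degree one. Then the similarity class in $\mathrm{M}_n(A)$ (with characteristic polynomial $f(x)$) that corresponds to the ideal class of $\mathfrak{b}$ under the Latimer--MacDuffee correspondence contains a matrix of the form $C_f(a,z)$, where $a,z\in A$ and $f(z)\equiv 0 \bmod (a)$. In particular, if $A[\theta]=B$, then every similarity class in $\mathrm{M}_n(A)$ of matrices with characteristic polynomial $f(x)$ contains a matrix of the form $C_f(a,z)$ with $a,z\in A$ and $f(z)\equiv 0\bmod (a)$.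
   Context: Degree one: a proper ideal $\mathfrak{b}$ of $A[\theta]$ is of degree one (over $A$) if $A+\mathfrak{b}=A[\theta]$. Similarity classes in $\mathrm{M}_n(A)$ are the orbits of $\mathrm{GL}_n(A)$ acting on $\mathrm{M}_n(A)$ by conjugation. Ideal classes of $A[\theta]$: two non-zero ideals $I,J$ are in the same class if $xI=yJ$ for some non-zero $x,y\in A[\theta]$. Latimer--MacDuffee correspondence: the bijection between similarity classes of matrices in $\mathrm{M}_n(A)$ with characteristic polynomial $f(x)$ and ideal classes of $A[\theta]$ given as follows. If $\alpha\in \mathrm{M}_n(A)$ has characteristic polynomial $f(x)$, choose a non-zero column vector $v=(v_1,\dots,v_n)^{T}\in A[\theta]^n$ with $\alpha v=\theta v$; then $I=Av_1+\dots+Av_n$ is an ideal of $A[\theta]$, and the similarity class of $\alpha$ corresponds to the ideal class of $I$ (this is independent of the choices). The matrix $C_f(a,z)$: for $a,z\in A$ with $a\mid f(z)$ (hence $a\neq 0$, as $f$ is irreducible of degree $n\geq 2$), put $u_i=-(z^i+k_{n-1}z^{i-1}+k_{n-2}z^{i-2}+\dots+k_{n-i+1}z+k_{n-i})$ for $i=1,\dots,n-1$. Then $C_f(a,z)\in \mathrm{M}_n(A)$ is the matrix whose row $i$, for $1\le i\le n-2$, has a $1$ in column $i+1$ and zeros elsewhere; whose row $n-1$ is $(u_{n-1},u_{n-2},\dots,u_1,-f(z)a^{-1})$; and whose row $n$ is $(a,0,\dots,0,z)$. For $n=2$ this is $\begin{pmatrix}u_1 & -f(z)a^{-1}\\ a&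 z\end{pmatrix}$. *)

theory Defs
  imports
    "HOL-Algebra.Ring_Divisibility"
    "HOL-Algebra.Generated_Fields"
    "HOL-Computational_Algebra.Polynomial_Factorial"
    "Jordan_Normal_Form.VS_Connect"
    "Jordan_Normal_Form.Char_Poly"
begin

text \<open>
  Conventions. The principal ideal domain \<open>A\<close> is the type \<open>'a\<close>, its field of fractions \<open>K\<close> is
  \<open>'a fract\<close>, and an extension \<open>L/K\<close> is a field type \<open>'l\<close> together with a field homomorphism
  \<open>h :: 'a fract \<Rightarrow> 'l\<close>. The subrings \<open>A[\<theta>]\<close> and \<open>B\<close> of \<open>L\<close>, and ideals of \<open>A[\<theta>]\<close>, are sets of
  elements of \<open>'l\<close>.
\<close>

definition base_emb :: "('a::idom fract \<Rightarrow> 'l::field) \<Rightarrow> 'a \<Rightarrow> 'l" where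
  "base_emb h a = h (to_fract a)"

definition minimal_polynomial :: "('k::field \<Rightarrow> 'l::field) \<Rightarrow> 'k poly \<Rightarrow> 'l \<Rightarrow> bool" where
  "minimal_polynomial h p x \<longleftrightarrow>
     lead_coeff p = 1 \<and> poly (map_poly h p) x = 0 \<and>
     (\<forall>q. q \<noteq> 0 \<and> poly (map_poly h q) x = 0 \<longrightarrow> degree p \<le> degree q)"

definition separable_extension :: "('k::field \<Rightarrow> 'l::field) \<Rightarrow> bool" where
  "separable_extension h \<longleftrightarrow>
     (\<forall>x. \<exists>p. minimal_polynomial h p x \<and> coprime p (pderiv p))"

text \<open>
  \<open>vector_space.dim\<close> is \<open>0\<close> for spaces that are not finite-dimensional, so degree \<open>n > 0\<close> includes
  finiteness of the extension.
\<close>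

definition extension_degree :: "('k::field \<Rightarrow> 'l::field) \<Rightarrow> nat" where
  "extension_degree h = vector_space.dim (\<lambda>c x. h c * x) (UNIV :: 'l set)"

definition integral_closure :: "('a::idom fract \<Rightarrow> 'l::field) \<Rightarrow> 'l set" where
  "integral_closure h =
     {x. \<exists>p. lead_coeff p = 1 \<and> poly (map_poly (base_emb h) p) x = 0}"

definition adjoin :: "('a::idom fract \<Rightarrow> 'l::field) \<Rightarrow> 'l \<Rightarrow> 'l set" where
  "adjoin h \<theta> = range (\<lambda>p. poly (map_poly (base_emb h) p) \<theta>)"

definition adjoin_ring :: "('a::idom fract \<Rightarrow> 'l::field) \<Rightarrow> 'l \<Rightarrow> 'l ring" where
  "adjoin_ring h \<theta> = class_ring\<lparr>carrier := adjoin h \<theta>\<rparr>"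

definition degree_one_ideal :: "('a::idom fract \<Rightarrow> 'l::field) \<Rightarrow> 'l \<Rightarrow> 'l set \<Rightarrow> bool" where
  "degree_one_ideal h \<theta> b \<longleftrightarrow>
     ideal b (adjoin_ring h \<theta>) \<and> b \<noteq> adjoin h \<theta> \<and>
     range (base_emb h) <+>\<^bsub>adjoin_ring h \<theta>\<^esub> b = adjoin h \<theta>"

definition ideal_class :: "('a::idom fract \<Rightarrow> 'l::field) \<Rightarrow> 'l \<Rightarrow> 'l set \<Rightarrow> 'l set set" where
  "ideal_class h \<theta> I =
     {J. ideal J (adjoin_ring h \<theta>) \<and> J \<noteq> {0} \<and>
         (\<exists>x \<in> adjoin h \<theta> - {0}. \<exists>y \<in> adjoin h \<theta> - {0}. (\<lambda>t. x * t) ` I = (\<lambda>t. y * t) ` J)}"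

definition similarity_class :: "nat \<Rightarrow> 'a::comm_ring_1 mat \<Rightarrow> 'a mat set" where
  "similarity_class n \<alpha> = {\<beta> \<in> carrier_mat n n. similar_mat \<beta> \<alpha>}"

definition similarity_classes :: "nat \<Rightarrow> 'a::comm_ring_1 poly \<Rightarrow> 'a mat set set" where
  "similarity_classes n f =
     {similarity_class n \<alpha> | \<alpha>. \<alpha> \<in> carrier_mat n n \<and> char_poly \<alpha> = f}"

definition base_span :: "('a::idom fract \<Rightarrow> 'l::field) \<Rightarrow> 'l vec \<Rightarrow> 'l set" where
  "base_span h v = range (\<lambda>c :: nat \<Rightarrow> 'a. \<Sum>i<dim_vec v. base_emb h (c i) * v $ i)"

text \<open>
  The Latimer--MacDuffee correspondence, from similarity classes to ideal classes. The description
  \<open>THE\<close> is justified by independence of the choices of \<open>\<alpha>\<close> and \<open>v\<close>.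
\<close>

definition latimer_macduffee ::
    "('a::idom fract \<Rightarrow> 'l::field) \<Rightarrow> 'l \<Rightarrow> 'a mat set \<Rightarrow> 'l set set" where
  "latimer_macduffee h \<theta> S =
     (THE C. \<exists>\<alpha> \<in> S. \<exists>v. set\<^sub>v v \<subseteq> adjoin h \<theta> \<and>
        eigenvector (map_mat (base_emb h) \<alpha>) v \<theta> \<and>
        C = ideal_class h \<theta> (base_span h v))"

definition corresponding_similarity_class ::
    "('a::idom fract \<Rightarrow> 'l::field) \<Rightarrow> 'l \<Rightarrow> nat \<Rightarrow> 'a poly \<Rightarrow> 'l set set \<Rightarrow> 'a mat set" where
  "corresponding_similarity_class h \<theta> n f =
     the_inv_into (similarity_classes n f) (latimer_macduffee h \<theta>)"

definition u_coeff :: "nat \<Rightarrow> 'a::comm_ring_1 poly \<Rightarrow> 'a \<Rightarrow> nat \<Rightarrow> 'a" where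
  "u_coeff n f z i = - (z ^ i + (\<Sum>j = 1..i. coeff f (n - j) * z ^ (i - j)))"

text \<open>
  Matrix indices start at \<open>0\<close>, so the rows \<open>1, \<dots>, n - 2\<close>, \<open>n - 1\<close>, \<open>n\<close> are here the rows \<open>i < n - 2\<close>,
  \<open>n - 2\<close>, \<open>n - 1\<close>. The matrix is meant for \<open>n \<ge> 2\<close> and \<open>a \<noteq> 0\<close> dividing \<open>f(z)\<close>, in which case
  \<open>div\<close> is exact division.
\<close>

definition C_mat :: "nat \<Rightarrow> 'a::idom_divide poly \<Rightarrow> 'a \<Rightarrow> 'a \<Rightarrow> 'a mat" where
  "C_mat n f a z = mat n n (\<lambda>(i, j).
     if i < n - 2 then (if j = i + 1 then 1 else 0)
     else if i = n - 2 then
       (if j = n - 1 then - (poly f z div a) else u_coeff n f z (n - 1 - j))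
     else (if j = 0 then a else if j = n - 1 then z else 0))"

end

theory Submission
  imports Defs
begin

text \<open>
  An eigenvector \<open>v\<close> of \<open>\<alpha>\<close> for \<open>\<theta>\<close> with entries in \<open>A[\<theta>]\<close> is unique up to scaling, and \<open>\<alpha>\<close> is determined
  up to similarity by the module spanned by its entries. An ideal of degree one has the \<open>A\<close>-basis
  \<open>(\<theta> - z) \<theta>\<^sup>i\<close> (\<open>i \<le> n - 2\<close>), \<open>a\<close>, which is an eigenvector of \<open>C\<^sub>f(a, z)\<close>.

  If \<open>A[\<theta>]\<close> is integrally closed and \<open>J\<close> is the ideal of an arbitrary class, it suffices to find \<open>x \<in> J\<close>
  such that \<open>J\<close> modulo the span of \<open>x, \<theta> x, \<dots>, \<theta>\<^bsup>n-2\<^esup> x\<close> is torsion-free: this span is then complemented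
  in \<open>J\<close> by some \<open>A w\<close>, and writing \<open>\<theta> w\<close> in the resulting basis shows that \<open>J\<close> is equivalent to an
  ideal with a basis as above. The condition on \<open>x\<close> is local. Let \<open>N \<in> J\<close> be a non-zero element of \<open>A\<close>. At the
  finitely many primes dividing \<open>N\<close> one takes a local generator of \<open>J\<close>, by the Chinese remainder theorem.
  Elsewhere \<open>J\<close> is locally trivial, and \<open>x = N + t (w - N)\<close>, with \<open>w\<close> congruent to the local generators
  and generating \<open>L\<close>, has the property wherever \<open>w\<close> generates \<open>A[\<theta>]\<close> locally, since an eigenspace of
  \<open>w\<close> modulo such a prime is an eigenspace of \<open>\<theta>\<close>; at the finitely many other primes \<open>t\<close> is made
  divisible by the prime.
\<close>

section \<open>Principal ideal domains\<close>

lemma irreducible_dvd_sym: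
  fixes p q :: "'a::idom"
  assumes "irreducible p" "irreducible q" "p dvd q"
  shows "q dvd p"
proof -
  obtain c where c: "q = p * c" using assms(3) by (elim dvdE)
  then have "c dvd 1" using irreducibleD[OF assms(2) c] assms(1) by (auto simp: irreducible_def)
  then obtain d where "1 = c * d" by (elim dvdE)
  then have "p = q * d" using c by (simp add: mult.assoc)
  then show ?thesis by simp
qed

locale pid_type =
  fixes ty :: "'a::idom_divide itself"
  assumes principal: "principal_domain (class_ring :: 'a ring)"
begin

lemma ideal_principal:
  fixes I :: "'a set"
  assumes zero: "0 \<in> I" and add: "\<And>x y. x \<in> I \<Longrightarrow> y \<in> I \<Longrightarrow> x + y \<in> I"
    and mult: "\<And>r x. x \<in> I \<Longrightarrow> r * x \<in> I"
  obtains a where "I = {x. a dvd x}"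
proof -
  interpret principal_domain "class_ring :: 'a ring" by (rule principal)
  have "additive_subgroup I (class_ring :: 'a ring)"
  proof (rule additive_subgroup.intro, rule group.subgroupI)
    show "group (add_monoid (class_ring :: 'a ring))"
      by (rule add.group_axioms)
  next
    fix x assume "x \<in> I"
    have "inv\<^bsub>add_monoid (class_ring :: 'a ring)\<^esub> x = - x"
      unfolding a_inv_def[symmetric] by (simp add: class_ring_simps)
    then show "inv\<^bsub>add_monoid (class_ring :: 'a ring)\<^esub> x \<in> I"
      using mult[OF \<open>x \<in> I\<close>, of "-1"] by simp
  qed (use zero add in auto)
  then have "ideal I (class_ring :: 'a ring)"
    by (intro ideal.intro ideal_axioms.intro class_ring.ring_axioms) (use mult in \<open>auto simp: mult.commute\<close>)
  from exists_gen[OF this] obtain a where "I = PIdl\<^bsub>(class_ring :: 'a ring)\<^esub> a" by blast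
  then have "I = {x. a dvd x}"
    unfolding cgenideal_def by (auto simp: dvd_def mult.commute)
  then show thesis by (rule that)
qed

lemma bezout:
  fixes a b :: 'a
  obtains u v where "u * a + v * b dvd a" "u * a + v * b dvd b"
proof -
  define I where "I = {x. \<exists>u v. x = u * a + v * b}"
  have 1: "x + y \<in> I" if "x \<in> I" "y \<in> I" for x y
  proof -
    from that obtain u v u' v' where "x = u * a + v * b" "y = u' * a + v' * b"
      unfolding I_def by blast
    then have "x + y = (u + u') * a + (v + v') * b" by (simp add: algebra_simps)
    then show ?thesis unfolding I_def by blast
  qed
  have 2: "r * x \<in> I" if "x \<in> I" for r x
  proof -
    from that obtain u v where "x = u * a + v * b" unfolding I_def by blast
    then have "r * x = (r * u) * a + (r * v) * b" by (simp add: algebra_simps)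
    then show ?thesis unfolding I_def by blast
  qed
  have "0 \<in> I" unfolding I_def by (auto intro!: exI[of _ 0])
  then obtain d where d: "I = {x. d dvd x}"
    using ideal_principal[OF _ 1 2] by metis
  then have "d \<in> I" by simp
  moreover have "a \<in> I" "b \<in> I"
    unfolding I_def mem_Collect_eq
    by (rule exI[of _ 1], rule exI[of _ 0], simp) (rule exI[of _ 0], rule exI[of _ 1], simp)
  ultimately obtain u v where "d = u * a + v * b" "d dvd a" "d dvd b"
    using d unfolding I_def by blast
  then show thesis using that by blast
qed

lemma irreducible_coprime:
  fixes p c :: 'a
  assumes "irreducible p" "\<not> p dvd c"
  obtains u v where "u * c + v * p = 1"
proof -
  obtain u v where uv: "u * c + v * p dvd c" "u * c + v * p dvd p" by (rule bezout)
  then obtain e where e: "p = (u * c + v * p) * e" by (elim dvdE)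
  have "\<not> e dvd 1"
  proof
    assume "e dvd 1"
    then obtain e' where "1 = e * e'" by (elim dvdE)
    then have "u * c + v * p = p * e'" using e by (metis mult.assoc mult.right_neutral)
    then show False using uv(1) assms(2) by (metis dvd_trans dvd_triv_left)
  qed
  then have "u * c + v * p dvd 1" using irreducibleD[OF assms(1) e] by blast
  then obtain w where w: "(u * c + v * p) * w = 1" by (metis dvd_def)
  show thesis
    by (rule that[of "w * u" "w * v"]) (use w in \<open>simp add: algebra_simps\<close>)
qed

lemma irreducible_prime:
  fixes p a b :: 'a
  assumes "irreducible p" "p dvd a * b"
  shows "p dvd a \<or> p dvd b"
proof (rule disjCI)
  assume "\<not> p dvd b"
  then obtain u v where "u * b + v * p = 1" using irreducible_coprime assms(1) by metis
  then have "a = u * (a * b) + a * v * p" by (metis distrib_left mult.assoc mult.left_commute mult_1_right)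
  then show "p dvd a" using assms(2) by (metis dvd_add dvd_mult dvd_triv_right)
qed

lemma wf_proper_dvd: "wf {(a, b :: 'a). a dvd b \<and> \<not> b dvd a}"
  unfolding wf_iff_no_infinite_down_chain
proof
  assume "\<exists>s. \<forall>i. (s (Suc i), s i :: 'a) \<in> {(a, b). a dvd b \<and> \<not> b dvd a}"
  then obtain s :: "nat \<Rightarrow> 'a" where s: "\<And>i. s (Suc i) dvd s i" "\<And>i. \<not> s i dvd s (Suc i)" by auto
  have anti: "s j dvd s i" if "i \<le> j" for i j
    using that by (induction rule: dec_induct) (use s(1) dvd_trans in auto)
  define I where "I = {x. \<exists>i. s i dvd x}"
  have "x + y \<in> I" if "x \<in> I" "y \<in> I" for x y
  proof -
    from that obtain i j where "s i dvd x" "s j dvd y" unfolding I_def by blast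
    then have "s (max i j) dvd x" "s (max i j) dvd y"
      using anti dvd_trans max.cobounded1 max.cobounded2 by metis+
    then show ?thesis unfolding I_def by (auto intro: dvd_add)
  qed
  moreover have "0 \<in> I" unfolding I_def by auto
  moreover have "r * x \<in> I" if "x \<in> I" for r x
    using that unfolding I_def by (auto intro: dvd_mult)
  ultimately obtain d where d: "I = {x. d dvd x}" using ideal_principal by metis
  have "d \<in> I" using d by simp
  then obtain i where "s i dvd d" unfolding I_def by auto
  moreover have "s (Suc i) \<in> I" unfolding I_def mem_Collect_eq by (rule exI[of _ "Suc i"]) (rule dvd_refl)
  then have "d dvd s (Suc i)" using d by simp
  ultimately show False using s(2) dvd_trans by blast
qed

lemma irreducible_divisor:
  fixes a :: 'a
  assumes "a \<noteq> 0" "\<not> a dvd 1"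
  shows "\<exists>p. irreducible p \<and> p dvd a"
  using assms
proof (induction a rule: wf_induct_rule[OF wf_proper_dvd])
  case (1 a)
  show ?case
  proof (cases "irreducible a")
    case False
    then obtain b c where bc: "a = b * c" "\<not> b dvd 1" "\<not> c dvd 1"
      using 1(2,3) unfolding irreducible_def by blast
    then have "\<not> a dvd b" using 1(2) by (metis dvd_mult_cancel_left mult.right_neutral mult_zero_left)
    then show ?thesis using 1(1)[of b] bc 1(2) by auto
  qed auto
qed

lemma factor_induct [consumes 1, case_names unit factor]:
  fixes a :: 'a
  assumes "a \<noteq> 0"
    and unit: "\<And>a. a dvd 1 \<Longrightarrow> P a"
    and factor: "\<And>p a. irreducible p \<Longrightarrow> a \<noteq> 0 \<Longrightarrow> P a \<Longrightarrow> P (p * a)"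
  shows "P a"
  using assms(1)
proof (induction a rule: wf_induct_rule[OF wf_proper_dvd])
  case (1 a)
  show ?case
  proof (cases "a dvd 1")
    case False
    then obtain p b where p: "irreducible p" "a = p * b"
      using irreducible_divisor[of a] 1(2) by (auto elim: dvdE)
    then have "b \<noteq> 0" "\<not> p dvd 1" using 1(2) by (auto simp: irreducible_def)
    then have "\<not> a dvd b" using dvd_mult_cancel_right[of p b 1] p(2) by simp
    then show ?thesis using 1(1)[of b] p factor[of p b] \<open>b \<noteq> 0\<close> by auto
  qed (rule unit)
qed

lemma congruent_one_divisible:
  fixes N R :: 'a
  assumes "R \<noteq> 0"
  shows "\<exists>t. N dvd t - 1 \<and> (\<forall>p. irreducible p \<longrightarrow> p dvd R \<longrightarrow> \<not> p dvd N \<longrightarrow> p dvd t)"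
  using assms
proof (induction R rule: factor_induct)
  case (unit a)
  then show ?case by (intro exI[of _ 1]) (metis diff_self dvd_0_right dvd_trans irreducible_def)
next
  case (factor p R)
  then obtain t where t: "N dvd t - 1" "\<And>p. irreducible p \<Longrightarrow> p dvd R \<Longrightarrow> \<not> p dvd N \<Longrightarrow> p dvd t"
    by blast
  show ?case
  proof (cases "p dvd N")
    case True
    have "q dvd t" if "irreducible q" "q dvd p * R" "\<not> q dvd N" for q
      using irreducible_prime[OF that(1,2)] True t(2) that dvd_trans by blast
    then show ?thesis using t(1) by blast
  next
    case False
    then obtain u v where uv: "u * N + v * p = 1" using irreducible_coprime factor by metis
    have "t * (v * p) - 1 = (t - 1) * (v * p) - u * N"
      using uv by (simp add: algebra_simps)
    then have "N dvd t * (v * p) - 1" using t(1) by (metis dvd_diff dvd_mult2 dvd_triv_right)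
    moreover have "q dvd t * (v * p)" if "irreducible q" "q dvd p * R" "\<not> q dvd N" for q
      using irreducible_prime[OF that(1,2)] t(2) that by (meson dvd_mult dvd_mult2)
    ultimately show ?thesis by blast
  qed
qed

context
  fixes p :: 'a
  assumes p: "irreducible p"
begin

lemma reduce_lead_coeff:
  fixes g :: "'a poly"
  shows "\<exists>b r. g = smult p b + r \<and> degree r \<le> degree g \<and> (r = 0 \<or> \<not> p dvd lead_coeff r)"
proof (induction "degree g" arbitrary: g rule: less_induct)
  case less
  show ?case
  proof (cases "p dvd lead_coeff g")
    case True
    then obtain c where c: "lead_coeff g = p * c" by (auto elim: dvdE)
    define g' where "g' = g - smult p (monom c (degree g))"
    have "degree g' \<le> degree g" unfolding g'_def
      by (intro degree_diff_le degree_smult_le[THEN le_trans] degree_monom_le) auto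
    moreover have "coeff g' (degree g) = 0" unfolding g'_def using c by simp
    ultimately have d: "degree g' < degree g \<or> g' = 0"
      by (metis le_neq_implies_less leading_coeff_0_iff)
    have g: "g = smult p (monom c (degree g)) + g'" unfolding g'_def by simp
    show ?thesis
    proof (cases "g' = 0")
      case True
      then show ?thesis using g by (intro exI[of _ "monom c (degree g)"] exI[of _ 0]) auto
    next
      case False
      then obtain b r where br: "g' = smult p b + r" "degree r \<le> degree g'" "r = 0 \<or> \<not> p dvd lead_coeff r"
        using less d by blast
      have "g = smult p (monom c (degree g) + b) + r" using g br(1) by (simp add: smult_add_right add.assoc)
      then show ?thesis using br d False
        by (intro exI[of _ "monom c (degree g) + b"] exI[of _ r]) (auto simp del: smult_add_right)
    qed
  qed (auto intro: exI[of _ 0])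
qed

lemma division_mod:
  fixes g h :: "'a poly"
  assumes h: "\<not> p dvd lead_coeff h"
  shows "\<exists>a b r. g = a * h + smult p b + r \<and> (r = 0 \<or> degree r < degree h)"
proof (induction "degree g" arbitrary: g rule: less_induct)
  case less
  show ?case
  proof (cases "degree g < degree h")
    case False
    obtain u v where uv: "u * lead_coeff h + v * p = 1" using irreducible_coprime[OF p h] by metis
    define k where "k = degree g - degree h"
    have k: "degree g = k + degree h" using False k_def by simp
    define m where "m = monom (u * lead_coeff g) k"
    define w where "w = monom (v * lead_coeff g) (degree g)"
    define g' where "g' = g - m * h - smult p w"
    have g: "g = m * h + smult p w + g'" unfolding g'_def by simp
    have "degree (m * h) \<le> degree g" unfolding k m_def
      by (intro degree_mult_le[THEN le_trans] add_mono degree_monom_le) auto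
    then have "degree g' \<le> degree g" unfolding g'_def w_def
      by (intro degree_diff_le degree_smult_le[THEN le_trans] degree_monom_le) auto
    moreover have "coeff (m * h) (degree g) = u * lead_coeff g * lead_coeff h"
      unfolding k m_def by (simp add: coeff_monom_mult)
    then have "coeff g' (degree g) = 0"
      unfolding g'_def w_def using arg_cong[OF uv, of "\<lambda>x. x * lead_coeff g"]
      by (simp add: algebra_simps)
    ultimately have "degree g' < degree g \<or> g' = 0"
      by (metis le_neq_implies_less leading_coeff_0_iff)
    then show ?thesis
    proof
      assume "g' = 0"
      then show ?thesis using g by (metis)
    next
      assume "degree g' < degree g"
      then obtain a b r where abr: "g' = a * h + smult p b + r" "r = 0 \<or> degree r < degree h"
        using less by blast
      have "g = (m + a) * h + smult p (w + b) + r"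
        using g abr(1) by (simp add: algebra_simps smult_add_right)
      then show ?thesis using abr(2) by blast
    qed
  qed (intro exI[of _ 0] exI[of _ g], simp)
qed

lemma poly_ideal_principal:
  fixes I :: "'a poly set"
  assumes pI: "[:p:] \<in> I" and add: "\<And>x y. x \<in> I \<Longrightarrow> y \<in> I \<Longrightarrow> x + y \<in> I"
    and mult: "\<And>r x. x \<in> I \<Longrightarrow> r * x \<in> I"
  shows "\<exists>g\<in>I. \<forall>e\<in>I. \<exists>a b. e = a * g + smult p b"
proof (cases "\<forall>e\<in>I. \<exists>b. e = smult p b")
  case True
  then show ?thesis using pI by (intro bexI[of _ "[:p:]"]) (auto intro: exI[of _ 0])
next
  case False
  have pb: "smult p b \<in> I" for b using mult[OF pI, of b] by simp
  have diff: "x - y \<in> I" if "x \<in> I" "y \<in> I" for x y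
    using add[OF that(1) mult[OF that(2), of "-1"]] by simp
  have r: "r \<in> I" if "e = y + r" "e \<in> I" "y \<in> I" for e y r
    using diff[OF that(2,3)] that(1) by simp
  define S where "S = {g \<in> I. \<not> p dvd lead_coeff g}"
  have "S \<noteq> {}"
  proof -
    obtain e where e: "e \<in> I" "\<And>b. e \<noteq> smult p b" using False by blast
    obtain b r where br: "e = smult p b + r" "r = 0 \<or> \<not> p dvd lead_coeff r"
      using reduce_lead_coeff by blast
    then have "r \<noteq> 0" using e(2)[of b] by auto
    then have "r \<in> S" using br(2) r[OF br(1) e(1) pb] unfolding S_def by auto
    then show ?thesis by blast
  qed
  then obtain g where g: "g \<in> S" "\<And>h. h \<in> S \<Longrightarrow> degree g \<le> degree h"
    using ex_has_least_nat[of "\<lambda>g. g \<in> S" _ degree] by blast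
  have "\<exists>a b. e = a * g + smult p b" if e: "e \<in> I" for e
  proof -
    obtain a b r where abr: "e = a * g + smult p b + r" "r = 0 \<or> degree r < degree g"
      using division_mod[of g e] g(1) unfolding S_def by blast
    obtain c s where cs: "r = smult p c + s" "degree s \<le> degree r" "s = 0 \<or> \<not> p dvd lead_coeff s"
      using reduce_lead_coeff by blast
    have "r = 0 \<or> s = 0"
    proof (rule ccontr)
      assume "\<not> (r = 0 \<or> s = 0)"
      then have "r \<noteq> 0" and s: "s \<noteq> 0" by auto
      have "r \<in> I"
        by (rule r[OF abr(1) e], rule add[OF mult pb]) (use g(1) S_def in auto)
      then have "s \<in> I" using r[OF cs(1) _ pb] by blast
      then have "s \<in> S" using s cs(3) S_def by auto
      then have "degree g \<le> degree s" by (rule g(2))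
      then show False using abr(2) cs(2) \<open>r \<noteq> 0\<close> by simp
    qed
    then have "e = a * g + smult p b \<or> e = a * g + smult p (b + c)"
      using abr cs by (auto simp: smult_add_right)
    then show ?thesis by blast
  qed
  then show ?thesis using g(1) S_def by blast
qed

lemma complementary_multipliers:
  fixes I J :: "'a poly set"
  assumes I: "[:p:] \<in> I" "\<And>x y. x \<in> I \<Longrightarrow> y \<in> I \<Longrightarrow> x + y \<in> I" "\<And>r x. x \<in> I \<Longrightarrow> r * x \<in> I"
    and J: "[:p:] \<in> J" "\<And>x y. x \<in> J \<Longrightarrow> y \<in> J \<Longrightarrow> x + y \<in> J" "\<And>r x. x \<in> J \<Longrightarrow> r * x \<in> J"
  obtains s where "\<And>e. e \<in> J \<Longrightarrow> s * e \<in> I" "\<And>e. e \<in> I \<Longrightarrow> (1 - s) * e \<in> J"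
proof -
  have pI: "smult p b \<in> I" for b using I(3)[OF I(1), of b] by simp
  have pJ: "smult p b \<in> J" for b using J(3)[OF J(1), of b] by simp
  obtain g where g: "g \<in> I" "\<And>e. e \<in> I \<Longrightarrow> \<exists>a b. e = a * g + smult p b"
    using poly_ideal_principal[OF I] by metis
  obtain h where h: "h \<in> J" "\<And>e. e \<in> J \<Longrightarrow> \<exists>a b. e = a * h + smult p b"
    using poly_ideal_principal[OF J] by metis
  define S where "S = {x. \<exists>a\<in>I. \<exists>b\<in>J. x = a + b}"
  have J0: "0 \<in> J" and I0: "0 \<in> I" using pJ[of 0] pI[of 0] by auto
  have "\<exists>d\<in>S. \<forall>e\<in>S. \<exists>a b. e = a * d + smult p b"
  proof (rule poly_ideal_principal)
    show "[:p:] \<in> S" unfolding S_def using I(1) J0 by force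
    show "x + y \<in> S" if "x \<in> S" "y \<in> S" for x y
    proof -
      from that obtain a b c d where "a \<in> I" "c \<in> I" "b \<in> J" "d \<in> J" "x = a + b" "y = c + d"
        unfolding S_def by blast
      then have "a + c \<in> I" "b + d \<in> J" "x + y = (a + c) + (b + d)" using I J by auto
      then show ?thesis unfolding S_def by blast
    qed
    show "r * x \<in> S" if "x \<in> S" for r x
      using that I(3) J(3) unfolding S_def by (force simp: distrib_left)
  qed
  then obtain d where d: "d \<in> S" "\<And>e. e \<in> S \<Longrightarrow> \<exists>a b. e = a * d + smult p b" by blast
  have "g \<in> S" "h \<in> S" unfolding S_def using g(1) h(1) I0 J0 by force+
  then obtain g1 g2 h1 h2 where gh: "g = g1 * d + smult p g2" "h = h1 * d + smult p h2"
    using d(2) by metis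
  obtain a b where ab: "a \<in> I" "b \<in> J" "d = a + b" using d(1) S_def by blast
  obtain u u' v v' where uv: "a = u * g + smult p u'" "b = v * h + smult p v'"
    using g(2)[OF ab(1)] h(2)[OF ab(2)] by blast
  define s where "s = u * g1"
  show thesis
  proof (rule that[of s])
    fix e assume "e \<in> J"
    then obtain y y' where e: "e = y * h + smult p y'" using h(2) by blast
    have "s * e = y * u * h1 * g + smult p (s * y' + y * s * h2 - y * u * h1 * g2)"
      unfolding e s_def gh by (simp add: algebra_simps smult_add_right smult_diff_right)
    then show "s * e \<in> I" using I g(1) pI by auto
  next
    fix e assume "e \<in> I"
    then obtain y y' where e: "e = y * g + smult p y'" using g(2) by blast
    have d': "d = u * g + v * h + smult p (u' + v')" using ab uv by (simp add: smult_add_right algebra_simps)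
    have "(1 - s) * d = v * h + smult p (u' + v' + u * g2)"
      using d' unfolding s_def gh(1) by (simp add: algebra_simps smult_add_right)
    have "(1 - s) * e = y * g1 * ((1 - s) * d) + smult p ((1 - s) * (y' + y * g2))"
      unfolding e gh(1) by (simp add: algebra_simps smult_add_right smult_diff_right)
    also note \<open>(1 - s) * d = _\<close>
    finally have "(1 - s) * e = y * g1 * v * h + smult p (y * g1 * (u' + v' + u * g2) + (1 - s) * (y' + y * g2))"
      by (simp add: algebra_simps smult_add_right smult_diff_right)
    then show "(1 - s) * e \<in> J" using J h(1) pJ by auto
  qed
qed

end

end

section \<open>Monogenic extensions\<close>

lemma monic_division:
  fixes g m :: "'a::comm_ring_1 poly"
  assumes m: "lead_coeff m = 1" "degree m > 0"
  shows "\<exists>q r. g = q * m + r \<and> degree r < degree m"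
proof (induction "degree g" arbitrary: g rule: less_induct)
  case less
  show ?case
  proof (cases "degree g < degree m")
    case False
    define k where "k = degree g - degree m"
    have k: "degree g = k + degree m" using False k_def by simp
    define w where "w = monom (lead_coeff g) k"
    define g' where "g' = g - w * m"
    have "degree (w * m) \<le> degree g" unfolding k w_def
      by (intro degree_mult_le[THEN le_trans] add_mono degree_monom_le) auto
    then have "degree g' \<le> degree g" unfolding g'_def
      by (intro degree_diff_le) auto
    moreover have "coeff (w * m) (degree g) = lead_coeff g"
      unfolding k w_def using m by (simp add: coeff_monom_mult)
    then have "coeff g' (degree g) = 0" unfolding g'_def by simp
    ultimately have "degree g' < degree g"
      using m(2) False by (metis le_neq_implies_less leading_coeff_0_iff degree_0 not_less_iff_gr_or_eq)
    then obtain q r where "g' = q * m + r" "degree r < degree m" using less by blast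
    moreover have "g = w * m + g'" unfolding g'_def by simp
    ultimately have "g = (w + q) * m + r \<and> degree r < degree m" by (simp add: algebra_simps)
    then show ?thesis by blast
  qed (intro exI[of _ 0] exI[of _ g], simp)
qed

lemma poly_as_sum_lessThan:
  fixes g :: "'a::comm_ring_1 poly"
  assumes "degree g < n"
  shows "g = (\<Sum>i<n. monom (coeff g i) i)"
proof -
  have "(\<Sum>i<n. monom (coeff g i) i) = (\<Sum>i\<le>degree g. monom (coeff g i) i)"
    using assms by (intro sum.mono_neutral_right) (auto simp: coeff_eq_0)
  then show ?thesis by (simp add: poly_as_sum_of_monoms)
qed

locale monogenic = pid_type ty for ty :: "'a::idom_divide itself" +
  fixes h :: "'a fract \<Rightarrow> 'l::field"
    and \<theta> :: 'l
    and f :: "'a poly"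
    and n :: nat
  assumes hom: "inj_idom_hom (base_emb h)"
    and monic: "lead_coeff f = 1"
    and degree_f: "degree f = n"
    and n2: "n \<ge> 2"
    and root: "poly (map_poly (base_emb h) f) \<theta> = 0"
    and independent: "\<And>g. degree g < n \<Longrightarrow> poly (map_poly (base_emb h) g) \<theta> = 0 \<Longrightarrow> g = 0"
    and fraction: "\<And>y. \<exists>N g. N \<noteq> 0 \<and> base_emb h N * y = poly (map_poly (base_emb h) g) \<theta>"
begin

abbreviation E :: "'a \<Rightarrow> 'l" where "E \<equiv> base_emb h"

abbreviation B :: "'l set" where "B \<equiv> adjoin h \<theta>"

sublocale E: inj_idom_hom E by (rule hom)
sublocale Ep: map_poly_inj_idom_hom E ..

definition ev :: "'a poly \<Rightarrow> 'l" where "ev g = poly (map_poly E g) \<theta>"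

lemma ev_add [simp]: "ev (g + g') = ev g + ev g'" by (simp add: ev_def Ep.hom_add)
lemma ev_diff [simp]: "ev (g - g') = ev g - ev g'" by (simp add: ev_def Ep.hom_minus)
lemma ev_uminus [simp]: "ev (- g) = - ev g" by (simp add: ev_def Ep.hom_uminus)
lemma ev_mult [simp]: "ev (g * g') = ev g * ev g'" by (simp add: ev_def Ep.hom_mult)
lemma ev_0 [simp]: "ev 0 = 0" by (simp add: ev_def)
lemma ev_1 [simp]: "ev 1 = 1" by (simp add: ev_def)
lemma ev_pCons [simp]: "ev (pCons c g) = E c + \<theta> * ev g" by (simp add: ev_def E.map_poly_pCons_hom)
lemma ev_smult [simp]: "ev (smult c g) = E c * ev g" by (simp add: ev_def E.map_poly_hom_smult)
lemma ev_monom [simp]: "ev (monom c k) = E c * \<theta> ^ k"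
  by (induction k) (auto simp: monom_0 monom_Suc)
lemma ev_sum: "ev (\<Sum>i\<in>S. g i) = (\<Sum>i\<in>S. ev (g i))"
  by (induction S rule: infinite_finite_induct) auto
lemma ev_f: "ev f = 0" using root by (simp add: ev_def)

lemma adjoin_iff: "y \<in> B \<longleftrightarrow> (\<exists>g. y = ev g)" by (auto simp: adjoin_def ev_def)

lemma ev_in: "ev g \<in> B" by (auto simp: adjoin_iff)

lemma ev_eq_0: "degree g < n \<Longrightarrow> ev g = 0 \<Longrightarrow> g = 0"
  using independent unfolding ev_def by blast

lemma ev_inj: "degree g < n \<Longrightarrow> degree g' < n \<Longrightarrow> ev g = ev g' \<Longrightarrow> g = g'"
  using ev_eq_0[of "g - g'"] degree_diff_less[of g n g'] by simp

lemma adjoin_repr: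
  assumes "y \<in> B"
  obtains g where "degree g < n" "y = ev g"
proof -
  obtain g where g: "y = ev g" using assms by (auto simp: adjoin_iff)
  obtain q r where "g = q * f + r" "degree r < degree f"
    using monic_division[of f g] monic degree_f n2 by auto
  then show thesis using that[of r] g degree_f ev_f by auto
qed

lemma adjoin_add: "x \<in> B \<Longrightarrow> y \<in> B \<Longrightarrow> x + y \<in> B"
  unfolding adjoin_iff by (metis ev_add)
lemma adjoin_mult: "x \<in> B \<Longrightarrow> y \<in> B \<Longrightarrow> x * y \<in> B"
  unfolding adjoin_iff by (metis ev_mult)
lemma adjoin_diff: "x \<in> B \<Longrightarrow> y \<in> B \<Longrightarrow> x - y \<in> B"
  unfolding adjoin_iff by (metis ev_diff)
lemma adjoin_uminus: "x \<in> B \<Longrightarrow> - x \<in> B"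
  unfolding adjoin_iff by (metis ev_uminus)
lemma adjoin_0: "0 \<in> B" and adjoin_1: "1 \<in> B"
  unfolding adjoin_iff by (metis ev_0, metis ev_1)
lemma adjoin_E: "E c \<in> B"
  unfolding adjoin_iff by (rule exI[of _ "[:c:]"]) simp
lemma adjoin_theta: "\<theta> \<in> B"
  unfolding adjoin_iff by (rule exI[of _ "[:0, 1:]"]) simp
lemma adjoin_power: "x \<in> B \<Longrightarrow> x ^ k \<in> B"
  by (induction k) (auto intro: adjoin_mult adjoin_1)
lemma adjoin_sum: "(\<And>i. i \<in> S \<Longrightarrow> g i \<in> B) \<Longrightarrow> sum g S \<in> B"
  by (induction S rule: infinite_finite_induct) (auto intro: adjoin_add adjoin_0)

lemmas adjoin_closed = adjoin_add adjoin_mult adjoin_diff adjoin_uminus adjoin_0 adjoin_1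
  adjoin_E adjoin_theta adjoin_power

lemma poly_eval_in:
  assumes "x \<in> B"
  shows "poly (map_poly E q) x \<in> B"
  by (induction q) (auto simp: E.map_poly_pCons_hom intro: adjoin_closed assms)

lemma ev_in_multiple:
  assumes "degree g < n" "b \<in> B" "ev g = E c * b"
  obtains g' where "degree g' < n" "g = smult c g'" "b = ev g'"
proof -
  obtain g' where g': "degree g' < n" "b = ev g'" using adjoin_repr assms(2) by blast
  have "g = smult c g'"
    using assms g' by (intro ev_inj) (auto intro: le_less_trans[OF degree_smult_le])
  then show thesis using that g' by blast
qed

lemma ex_norm:
  assumes "y \<in> B" "y \<noteq> 0"
  obtains y' N where "y' \<in> B" "N \<noteq> 0" "y * y' = E N"
proof -
  obtain N g where "N \<noteq> 0" "E N * inverse y = ev g" using fraction[of "inverse y"] ev_def by auto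
  then show thesis using that[of "ev g" N] assms ev_in by (auto simp: field_simps)
qed

lemma adjoin_coordinates:
  assumes "y \<in> B"
  obtains c where "y = (\<Sum>i<n. E (c i) * \<theta> ^ i)"
proof -
  obtain g where g: "degree g < n" "y = ev g" using adjoin_repr assms by blast
  have "y = (\<Sum>i<n. E (coeff g i) * \<theta> ^ i)"
    unfolding g(2) by (subst poly_as_sum_lessThan[OF g(1)]) (simp add: ev_sum)
  then show thesis by (rule that)
qed

lemma coordinates_unique:
  assumes "(\<Sum>i<n. E (c i) * \<theta> ^ i) = (\<Sum>i<n. E (d i) * \<theta> ^ i)" "i < n"
  shows "c i = d i"
proof -
  define g where "g c = (\<Sum>i<n. monom (c i :: 'a) i)" for c
  have deg: "degree (g c) < n" for c
  proof -
    have "degree (g c) \<le> n - 1" unfolding g_def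
      by (intro degree_sum_le) (auto intro: degree_monom_le[THEN le_trans])
    then show ?thesis using n2 by simp
  qed
  have "ev (g c) = ev (g d)" using assms(1) by (simp add: g_def ev_sum)
  then have "g c = g d" using deg ev_inj by blast
  then have "coeff (g c) i = coeff (g d) i" by simp
  then show ?thesis using assms(2) by (simp add: g_def coeff_sum)
qed

lemma base_span_iff:
  assumes "dim_vec v = n"
  shows "y \<in> base_span h v \<longleftrightarrow> (\<exists>c. y = (\<Sum>i<n. E (c i) * v $ i))"
  using assms unfolding base_span_def by auto

definition module_ideal :: "'l set \<Rightarrow> bool" where
  "module_ideal J \<longleftrightarrow> J \<subseteq> B \<and> J \<noteq> {0} \<and> 0 \<in> J \<and> (\<forall>x\<in>J. \<forall>y\<in>J. x + y \<in> J) \<and> (\<forall>b\<in>B. \<forall>x\<in>J. b * x \<in> J)"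

lemma module_idealD:
  assumes "module_ideal J"
  shows "x \<in> J \<Longrightarrow> x \<in> B" "0 \<in> J" "x \<in> J \<Longrightarrow> y \<in> J \<Longrightarrow> x + y \<in> J"
    "b \<in> B \<Longrightarrow> x \<in> J \<Longrightarrow> b * x \<in> J" "x \<in> J \<Longrightarrow> y \<in> J \<Longrightarrow> x - y \<in> J" "x \<in> J \<Longrightarrow> - x \<in> J"
    "x \<in> J \<Longrightarrow> E c * x \<in> J"
    "(\<And>i. i \<in> S \<Longrightarrow> g i \<in> J) \<Longrightarrow> sum g S \<in> J"
proof -
  show a: "x \<in> J \<Longrightarrow> x \<in> B" "0 \<in> J" "x \<in> J \<Longrightarrow> y \<in> J \<Longrightarrow> x + y \<in> J"
    "b \<in> B \<Longrightarrow> x \<in> J \<Longrightarrow> b * x \<in> J" for x y b using assms unfolding module_ideal_def by auto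
  show u: "x \<in> J \<Longrightarrow> - x \<in> J" for x using a(4)[of "- 1" x] adjoin_closed by simp
  show "x \<in> J \<Longrightarrow> y \<in> J \<Longrightarrow> x - y \<in> J" using a(3)[of x "- y"] u[of y] by simp
  show "x \<in> J \<Longrightarrow> E c * x \<in> J" using a(4) adjoin_E by blast
  show "(\<And>i. i \<in> S \<Longrightarrow> g i \<in> J) \<Longrightarrow> sum g S \<in> J"
    by (induction S rule: infinite_finite_induct) (auto intro: a)
qed

lemma ideal_iff: "ideal J (adjoin_ring h \<theta>) \<and> J \<noteq> {0} \<longleftrightarrow> module_ideal J"
proof
  interpret R: cring "adjoin_ring h \<theta>"
  proof (rule cringI)
    show "abelian_group (adjoin_ring h \<theta>)"
    proof (rule abelian_groupI)
      show "\<exists>y\<in>carrier (adjoin_ring h \<theta>). y \<oplus>\<^bsub>adjoin_ring h \<theta>\<^esub> x = \<zero>\<^bsub>adjoin_ring h \<theta>\<^esub>"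
        if "x \<in> carrier (adjoin_ring h \<theta>)" for x
        using that adjoin_uminus by (intro bexI[of _ "- x"]) (auto simp: adjoin_ring_def)
    qed (auto simp: adjoin_ring_def intro: adjoin_closed)
    show "comm_monoid (adjoin_ring h \<theta>)"
      by (rule comm_monoidI) (auto simp: adjoin_ring_def intro: adjoin_closed)
  qed (auto simp: adjoin_ring_def algebra_simps)
  have inv: "inv\<^bsub>add_monoid (adjoin_ring h \<theta>)\<^esub> x = - x" if "x \<in> B" for x
    unfolding a_inv_def[symmetric]
    by (rule R.minus_equality) (use that adjoin_uminus in \<open>auto simp: adjoin_ring_def\<close>)
  {
    assume J: "module_ideal J"
    have "additive_subgroup J (adjoin_ring h \<theta>)"
    proof (rule additive_subgroup.intro, rule group.subgroupI)
      show "group (add_monoid (adjoin_ring h \<theta>))" by (rule R.add.group_axioms)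
    next
      fix x assume "x \<in> J"
      then show "inv\<^bsub>add_monoid (adjoin_ring h \<theta>)\<^esub> x \<in> J"
        using inv[of x] module_idealD[OF J] by auto
    qed (use module_idealD[OF J] in \<open>auto simp: adjoin_ring_def\<close>)
    moreover have "x * a \<in> J" "a * x \<in> J" if "a \<in> J" "x \<in> B" for a x
      using module_idealD(4)[OF J that(2,1)] by (simp_all add: mult.commute)
    ultimately have "ideal J (adjoin_ring h \<theta>)"
      by (intro ideal.intro ideal_axioms.intro R.ring_axioms) (auto simp: adjoin_ring_def)
    then show "ideal J (adjoin_ring h \<theta>) \<and> J \<noteq> {0}" using J by (auto simp: module_ideal_def)
  next
    assume J: "ideal J (adjoin_ring h \<theta>) \<and> J \<noteq> {0}"
    then interpret J: ideal J "adjoin_ring h \<theta>" by simp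
    show "module_ideal J"
      unfolding module_ideal_def
    proof (intro conjI ballI)
      show "J \<subseteq> B" using J.a_subset by (simp add: adjoin_ring_def)
      show "0 \<in> J" using J.zero_closed by (simp add: adjoin_ring_def)
      show "x + y \<in> J" if "x \<in> J" "y \<in> J" for x y
        using J.a_closed[OF that] by (simp add: adjoin_ring_def)
      show "b * x \<in> J" if "b \<in> B" "x \<in> J" for b x
        using J.I_l_closed[OF that(2), of b] that(1) by (simp add: adjoin_ring_def)
    qed (use J in simp)
  }
qed

lemma module_ideal_contains_base:
  assumes "module_ideal J"
  obtains N where "N \<noteq> 0" "E N \<in> J"
proof -
  obtain y where y: "y \<in> J" "y \<noteq> 0" using assms unfolding module_ideal_def by blast
  then obtain y' N where N: "y' \<in> B" "N \<noteq> 0" "y * y' = E N"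
    using ex_norm module_idealD(1)[OF assms] by metis
  then have "E N \<in> J" using module_idealD(4)[OF assms, of y' y] y by (simp add: mult.commute)
  then show thesis using that N by blast
qed

text \<open>
  Between the bases \<open>N \<theta>\<^sup>j\<close> and \<open>\<theta>\<^sup>k\<close>, the coordinate matrices through \<open>v\<close> satisfy \<open>Q R = N\<close>, so
  \<open>R\<close> has non-zero determinant.
\<close>

lemma span_independent:
  assumes v: "\<And>i. i < n \<Longrightarrow> v i \<in> B"
    and N: "N \<noteq> 0" and span: "\<And>j. j < n \<Longrightarrow> \<exists>c. E N * \<theta> ^ j = (\<Sum>i<n. E (c i) * v i)"
    and dep: "(\<Sum>i<n. E (c i) * v i) = 0" and i: "i < n"
  shows "c i = 0"
proof -
  obtain q where q: "\<And>j. j < n \<Longrightarrow> E N * \<theta> ^ j = (\<Sum>i<n. E (q j i) * v i)" using span by metis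
  have "\<forall>i<n. \<exists>c. v i = (\<Sum>k<n. E (c k) * \<theta> ^ k)" using v adjoin_coordinates by metis
  then obtain r where r: "\<And>i. i < n \<Longrightarrow> v i = (\<Sum>k<n. E (r i k) * \<theta> ^ k)" by metis
  have expand: "(\<Sum>i<n. E (c i) * v i) = (\<Sum>k<n. E (\<Sum>i<n. c i * r i k) * \<theta> ^ k)" for c
  proof -
    have "(\<Sum>i<n. E (c i) * v i) = (\<Sum>i<n. \<Sum>k<n. E (c i) * (E (r i k) * \<theta> ^ k))"
      using r by (simp add: sum_distrib_left)
    also have "\<dots> = (\<Sum>k<n. \<Sum>i<n. E (c i) * (E (r i k) * \<theta> ^ k))" by (rule sum.swap)
    finally show ?thesis by (simp add: E.hom_sum E.hom_mult sum_distrib_right mult.assoc)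
  qed
  define Q where "Q = mat n n (\<lambda>(j, i). q j i)"
  define R where "R = mat n n (\<lambda>(i, k). r i k)"
  have QR: "Q \<in> carrier_mat n n" "R \<in> carrier_mat n n" by (auto simp: Q_def R_def)
  have prod: "Q * R = N \<cdot>\<^sub>m 1\<^sub>m n"
  proof (rule eq_matI)
    fix j k assume "j < dim_row (N \<cdot>\<^sub>m 1\<^sub>m n)" "k < dim_col (N \<cdot>\<^sub>m 1\<^sub>m n)"
    then have jk: "j < n" "k < n" by auto
    have "(\<Sum>k<n. E (\<Sum>i<n. q j i * r i k) * \<theta> ^ k) = (\<Sum>k<n. E (if k = j then N else 0) * \<theta> ^ k)"
      (is "?l = ?r")
    proof -
      have "?r = (\<Sum>k<n. if k = j then E N * \<theta> ^ j else 0)" by (intro sum.cong) auto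
      also have "\<dots> = E N * \<theta> ^ j" using jk(1) by simp
      finally show ?thesis using q[OF jk(1)] expand[of "q j"] by simp
    qed
    from coordinates_unique[OF this jk(2)]
    have "(\<Sum>i<n. q j i * r i k) = (if k = j then N else 0)" .
    moreover have "(Q * R) $$ (j, k) = (\<Sum>i<n. q j i * r i k)"
      using jk by (simp add: Q_def R_def scalar_prod_def lessThan_atLeast0)
    ultimately show "(Q * R) $$ (j, k) = (N \<cdot>\<^sub>m 1\<^sub>m n) $$ (j, k)" using jk by auto
  qed (use QR in auto)
  have "det (Q * R) \<noteq> 0" unfolding prod using N by simp
  then have det: "det R \<noteq> 0" using det_mult[OF QR] by auto
  have dep': "(\<Sum>k<n. E (\<Sum>i<n. c i * r i k) * \<theta> ^ k) = (\<Sum>k<n. E 0 * \<theta> ^ k)"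
    using dep unfolding expand by simp
  have zero: "(\<Sum>i<n. c i * r i k) = 0" if "k < n" for k
    by (rule coordinates_unique[OF dep' that])
  define w where "w = vec n c"
  have "transpose_mat R *\<^sub>v w = 0\<^sub>v n"
  proof (rule eq_vecI)
    fix k assume "k < dim_vec (0\<^sub>v n)"
    then have k: "k < n" by simp
    show "(transpose_mat R *\<^sub>v w) $ k = 0\<^sub>v n $ k"
      using k zero[OF k] by (simp add: R_def w_def scalar_prod_def lessThan_atLeast0 mult.commute)
  qed (simp add: R_def)
  moreover have "det (transpose_mat R) \<noteq> 0" using det det_transpose[OF QR(2)] by simp
  ultimately have "w = 0\<^sub>v n"
    using det_0_iff_vec_prod_zero[of "transpose_mat R" n] QR(2) vec_carrier[of n c]
    unfolding w_def by (metis transpose_carrier_mat)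
  then show ?thesis using i unfolding w_def by (metis index_vec index_zero_vec(1))
qed

section \<open>Eigenvectors and ideals\<close>

definition theta_eigenvector :: "'a mat \<Rightarrow> 'l vec \<Rightarrow> bool" where
  "theta_eigenvector \<alpha> v \<longleftrightarrow> set\<^sub>v v \<subseteq> B \<and> eigenvector (map_mat E \<alpha>) v \<theta>"

lemma theta_eigenvector_iff:
  assumes \<alpha>: "\<alpha> \<in> carrier_mat n n"
  shows "theta_eigenvector \<alpha> v \<longleftrightarrow>
    dim_vec v = n \<and> (\<forall>i<n. v $ i \<in> B) \<and> (\<exists>i<n. v $ i \<noteq> 0) \<and>
    (\<forall>i<n. \<theta> * v $ i = (\<Sum>j<n. E (\<alpha> $$ (i, j)) * v $ j))"
proof (cases "dim_vec v = n")
  case dim: True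
  have 1: "set\<^sub>v v \<subseteq> B \<longleftrightarrow> (\<forall>i<n. v $ i \<in> B)"
    using dim by (auto simp: vec_set_def)
  have 2: "v \<noteq> 0\<^sub>v n \<longleftrightarrow> (\<exists>i<n. v $ i \<noteq> 0)" using dim by (auto simp: vec_eq_iff)
  have 3: "map_mat E \<alpha> *\<^sub>v v = \<theta> \<cdot>\<^sub>v v \<longleftrightarrow>
    (\<forall>i<n. \<theta> * v $ i = (\<Sum>j<n. E (\<alpha> $$ (i, j)) * v $ j))"
  proof -
    have l: "(map_mat E \<alpha> *\<^sub>v v) $ i = (\<Sum>j<n. E (\<alpha> $$ (i, j)) * v $ j)" if "i < n" for i
      using that \<alpha> dim by (simp add: scalar_prod_def lessThan_atLeast0)
    have r: "(\<theta> \<cdot>\<^sub>v v) $ i = \<theta> * v $ i" if "i < n" for i using that dim by simp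
    show ?thesis
    proof (intro iffI allI impI eq_vecI)
      fix i assume eq: "map_mat E \<alpha> *\<^sub>v v = \<theta> \<cdot>\<^sub>v v" and i: "i < n"
      show "\<theta> * v $ i = (\<Sum>j<n. E (\<alpha> $$ (i, j)) * v $ j)"
        unfolding l[OF i, symmetric] r[OF i, symmetric] eq ..
    next
      fix i assume eq: "\<forall>i<n. \<theta> * v $ i = (\<Sum>j<n. E (\<alpha> $$ (i, j)) * v $ j)"
        and "i < dim_vec (\<theta> \<cdot>\<^sub>v v)"
      then have i: "i < n" using dim by simp
      show "(map_mat E \<alpha> *\<^sub>v v) $ i = (\<theta> \<cdot>\<^sub>v v) $ i"
        unfolding l[OF i] r[OF i] using eq i by simp
    qed (use \<alpha> dim in simp)
  qed
  have row: "dim_row (map_mat E \<alpha>) = n" using \<alpha> by simp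
  have "v \<in> carrier_vec n" using dim by (rule carrier_vecI)
  then show ?thesis
    unfolding theta_eigenvector_def eigenvector_def row 1 2 3 using dim by blast
next
  case False
  have row: "dim_row (map_mat E \<alpha>) = n" using \<alpha> by simp
  have "v \<notin> carrier_vec n" using False carrier_vecD by blast
  then show ?thesis using False unfolding theta_eigenvector_def eigenvector_def row by blast
qed

lemma theta_eigenvectorD:
  assumes "\<alpha> \<in> carrier_mat n n" "theta_eigenvector \<alpha> v"
  shows "dim_vec v = n" "i < n \<Longrightarrow> v $ i \<in> B" "\<exists>i<n. v $ i \<noteq> 0"
    "i < n \<Longrightarrow> \<theta> * v $ i = (\<Sum>j<n. E (\<alpha> $$ (i, j)) * v $ j)"
  using assms theta_eigenvector_iff by auto

lemma module_idealI:
  assumes "J \<subseteq> B" "J \<noteq> {0}" "0 \<in> J" and add: "\<And>x y. x \<in> J \<Longrightarrow> y \<in> J \<Longrightarrow> x + y \<in> J"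
    and scale: "\<And>c x. x \<in> J \<Longrightarrow> E c * x \<in> J" and theta: "\<And>x. x \<in> J \<Longrightarrow> \<theta> * x \<in> J"
  shows "module_ideal J"
proof -
  have "ev g * x \<in> J" if "x \<in> J" for g x
  proof (induction g)
    case (pCons c g)
    have "ev (pCons c g) * x = E c * x + \<theta> * (ev g * x)" by (simp add: algebra_simps)
    then show ?case using add scale theta pCons that by simp
  qed (simp add: assms)
  then show ?thesis unfolding module_ideal_def using assms adjoin_iff by auto
qed

lemma base_span_closed:
  assumes "dim_vec v = n"
  shows "0 \<in> base_span h v" "x \<in> base_span h v \<Longrightarrow> y \<in> base_span h v \<Longrightarrow> x + y \<in> base_span h v"
    "x \<in> base_span h v \<Longrightarrow> E c * x \<in> base_span h v"
    "i < n \<Longrightarrow> v $ i \<in> base_span h v"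
    "(\<And>i. i \<in> S \<Longrightarrow> g i \<in> base_span h v) \<Longrightarrow> sum g S \<in> base_span h v"
proof -
  show z: "0 \<in> base_span h v" unfolding base_span_iff[OF assms] by (rule exI[of _ "\<lambda>_. 0"]) simp
  show add: "x \<in> base_span h v \<Longrightarrow> y \<in> base_span h v \<Longrightarrow> x + y \<in> base_span h v" for x y
  proof -
    assume "x \<in> base_span h v" "y \<in> base_span h v"
    then obtain c d where "x = (\<Sum>i<n. E (c i) * v $ i)" "y = (\<Sum>i<n. E (d i) * v $ i)"
      unfolding base_span_iff[OF assms] by blast
    then have "x + y = (\<Sum>i<n. E (c i + d i) * v $ i)"
      by (simp add: E.hom_add distrib_right sum.distrib)
    then show ?thesis unfolding base_span_iff[OF assms] by (rule exI[of _ "\<lambda>i. c i + d i"])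
  qed
  show "x \<in> base_span h v \<Longrightarrow> E c * x \<in> base_span h v"
  proof -
    assume "x \<in> base_span h v"
    then obtain d where "x = (\<Sum>i<n. E (d i) * v $ i)"
      unfolding base_span_iff[OF assms] by blast
    then have "E c * x = (\<Sum>i<n. E (c * d i) * v $ i)"
      by (simp add: E.hom_mult sum_distrib_left mult.assoc)
    then show ?thesis unfolding base_span_iff[OF assms] by (rule exI[of _ "\<lambda>i. c * d i"])
  qed
  show "v $ i \<in> base_span h v" if "i < n"
  proof -
    have "(\<Sum>j<n. E (if j = i then 1 else 0) * v $ j) = (\<Sum>j<n. if j = i then v $ i else 0)"
      by (intro sum.cong) auto
    then have "v $ i = (\<Sum>j<n. E (if j = i then 1 else 0) * v $ j)" using that by simp
    then show ?thesis unfolding base_span_iff[OF assms]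
      by (rule exI[of _ "\<lambda>j. if j = i then 1 else 0"])
  qed
  show "(\<And>i. i \<in> S \<Longrightarrow> g i \<in> base_span h v) \<Longrightarrow> sum g S \<in> base_span h v"
    by (induction S rule: infinite_finite_induct) (auto intro: z add)
qed

lemma base_span_mono:
  assumes "dim_vec v = n" "dim_vec w = n" "\<And>i. i < n \<Longrightarrow> v $ i \<in> base_span h w"
  shows "base_span h v \<subseteq> base_span h w"
proof
  fix x assume "x \<in> base_span h v"
  then obtain d where "x = (\<Sum>i<n. E (d i) * v $ i)" unfolding base_span_iff[OF assms(1)] by blast
  also have "\<dots> \<in> base_span h w"
    by (intro base_span_closed(3,5)[OF assms(2)]) (use assms(3) in auto)
  finally show "x \<in> base_span h w" .
qed

lemma base_span_smult:
  assumes "dim_vec v = n"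
  shows "base_span h (x \<cdot>\<^sub>v v) = (\<lambda>t. x * t) ` base_span h v"
proof -
  have "y \<in> base_span h (x \<cdot>\<^sub>v v) \<longleftrightarrow> y \<in> (\<lambda>t. x * t) ` base_span h v" for y
  proof -
    have "(\<Sum>i<n. E (c i) * (x \<cdot>\<^sub>v v) $ i) = x * (\<Sum>i<n. E (c i) * v $ i)" for c
      using assms by (simp add: sum_distrib_left mult.left_commute)
    then have "y \<in> base_span h (x \<cdot>\<^sub>v v) \<longleftrightarrow> (\<exists>c. y = x * (\<Sum>i<n. E (c i) * v $ i))"
      using base_span_iff[of "x \<cdot>\<^sub>v v" y] assms by simp
    then show ?thesis using base_span_iff[OF assms] by (auto simp: image_iff)
  qed
  then show ?thesis by blast
qed

lemma span_module_ideal: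
  assumes \<alpha>: "\<alpha> \<in> carrier_mat n n" and v: "theta_eigenvector \<alpha> v"
  shows "module_ideal (base_span h v)"
proof -
  note D = theta_eigenvectorD[OF \<alpha> v]
  note C = base_span_closed[OF D(1)]
  show ?thesis
  proof (rule module_idealI)
    show "base_span h v \<subseteq> B"
      using D(2) by (auto simp: base_span_iff[OF D(1)] intro!: adjoin_sum adjoin_mult adjoin_E)
    show "base_span h v \<noteq> {0}" using D(3) C(4) by auto
    show "\<theta> * x \<in> base_span h v" if x: "x \<in> base_span h v" for x
    proof -
      obtain c where "x = (\<Sum>i<n. E (c i) * v $ i)" using x by (auto simp: base_span_iff[OF D(1)])
      then have "\<theta> * x = (\<Sum>i<n. E (c i) * (\<theta> * v $ i))" by (simp add: sum_distrib_left mult.left_commute)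
      also have "\<dots> = (\<Sum>i<n. E (c i) * (\<Sum>j<n. E (\<alpha> $$ (i, j)) * v $ j))"
        by (intro sum.cong refl arg_cong2[where f = "(*)"] D(4)) auto
      also have "\<dots> \<in> base_span h v" by (intro C(5,3)) (auto intro: C(4))
      finally show ?thesis .
    qed
  qed (use C in auto)
qed

lemma spanning_independent:
  assumes J: "module_ideal (base_span h v)" and v: "dim_vec v = n"
    and dep: "(\<Sum>i<n. E (c i) * v $ i) = 0" and i: "i < n"
  shows "c i = 0"
proof -
  obtain N where N: "N \<noteq> 0" "E N \<in> base_span h v" using module_ideal_contains_base[OF J] by blast
  have "E N * \<theta> ^ j \<in> base_span h v" for j
    using module_idealD(4)[OF J _ N(2), of "\<theta> ^ j"] adjoin_closed by (simp add: mult.commute)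
  then have "\<exists>c. E N * \<theta> ^ j = (\<Sum>i<n. E (c i) * v $ i)" for j
    using base_span_iff[OF v] by blast
  then show ?thesis
    using span_independent[of "\<lambda>i. v $ i" N c i] N(1) dep i
      module_idealD(1)[OF J base_span_closed(4)[OF v]] by blast
qed

lemma eigenvector_independent:
  assumes \<alpha>: "\<alpha> \<in> carrier_mat n n" and v: "theta_eigenvector \<alpha> v"
    and dep: "(\<Sum>i<n. E (c i) * v $ i) = 0" and i: "i < n"
  shows "c i = 0"
  using spanning_independent[OF span_module_ideal[OF \<alpha> v] theta_eigenvectorD(1)[OF \<alpha> v] dep i] .

lemma eigenvector_entry_nonzero:
  assumes \<alpha>: "\<alpha> \<in> carrier_mat n n" and v: "theta_eigenvector \<alpha> v" and k: "k < n"
  shows "v $ k \<noteq> 0"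
proof
  assume 0: "v $ k = 0"
  have "(\<Sum>i<n. E (if i = k then 1 else 0) * v $ i) = 0"
    using 0 by (intro sum.neutral) auto
  from eigenvector_independent[OF \<alpha> v this k] show False by simp
qed

lemma eigenvectors_proportional:
  assumes \<alpha>: "\<alpha> \<in> carrier_mat n n" and v: "theta_eigenvector \<alpha> v" and w: "theta_eigenvector \<alpha> w"
  obtains x y where "x \<in> B" "y \<in> B" "x \<noteq> 0" "y \<noteq> 0" "x \<cdot>\<^sub>v v = y \<cdot>\<^sub>v w"
proof -
  note V = theta_eigenvectorD[OF \<alpha> v] and W = theta_eigenvectorD[OF \<alpha> w]
  define u where "u = w $ 0 \<cdot>\<^sub>v v - v $ 0 \<cdot>\<^sub>v w"
  have u: "dim_vec u = n" "\<And>i. i < n \<Longrightarrow> u $ i = w $ 0 * v $ i - v $ 0 * w $ i"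
    unfolding u_def using V W by auto
  have 0: "(0::nat) < n" using n2 by simp
  have "\<not> theta_eigenvector \<alpha> u"
    using eigenvector_entry_nonzero[OF \<alpha> _ 0] u 0 by force
  moreover have "u $ i \<in> B" if "i < n" for i
    using u that V(2) W(2) 0 by (auto intro!: adjoin_diff adjoin_mult)
  moreover have "\<theta> * u $ i = (\<Sum>j<n. E (\<alpha> $$ (i, j)) * u $ j)" if i: "i < n" for i
  proof -
    have "\<theta> * u $ i = w $ 0 * (\<theta> * v $ i) - v $ 0 * (\<theta> * w $ i)"
      unfolding u(2)[OF i] by (simp add: right_diff_distrib mult.left_commute)
    also have "\<dots> = (\<Sum>j<n. E (\<alpha> $$ (i, j)) * (w $ 0 * v $ j - v $ 0 * w $ j))"
      unfolding V(4)[OF i] W(4)[OF i]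
      by (simp add: sum_distrib_left sum_subtractf[symmetric] algebra_simps)
    finally show ?thesis using u by simp
  qed
  ultimately have "u $ i = 0" if "i < n" for i
    using that u(1) unfolding theta_eigenvector_iff[OF \<alpha>] by blast
  then have "w $ 0 \<cdot>\<^sub>v v = v $ 0 \<cdot>\<^sub>v w"
    using u V W by (intro eq_vecI) auto
  then show thesis
    using that V(2) W(2) 0 eigenvector_entry_nonzero[OF \<alpha> v 0] eigenvector_entry_nonzero[OF \<alpha> w 0] by blast
qed

lemma eigenvector_smult:
  assumes \<alpha>: "\<alpha> \<in> carrier_mat n n" and v: "theta_eigenvector \<alpha> v" and "x \<in> B" "x \<noteq> 0"
  shows "theta_eigenvector \<alpha> (x \<cdot>\<^sub>v v)"
proof -
  note V = theta_eigenvectorD[OF \<alpha> v]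
  have "\<theta> * (x \<cdot>\<^sub>v v) $ i = (\<Sum>j<n. E (\<alpha> $$ (i, j)) * (x \<cdot>\<^sub>v v) $ j)" if i: "i < n" for i
  proof -
    have "\<theta> * (x \<cdot>\<^sub>v v) $ i = x * (\<theta> * v $ i)" using i V(1) by simp
    then show ?thesis unfolding V(4)[OF i] using V(1) by (simp add: sum_distrib_left mult.left_commute)
  qed
  then show ?thesis unfolding theta_eigenvector_iff[OF \<alpha>]
    using V assms(3,4) adjoin_mult by auto
qed

lemma coefficient_matrix:
  assumes "dim_vec w = n" "\<And>i. i < n \<Longrightarrow> v $ i \<in> base_span h w"
  obtains P where "P \<in> carrier_mat n n" "\<And>i. i < n \<Longrightarrow> v $ i = (\<Sum>j<n. E (P $$ (i, j)) * w $ j)"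
proof -
  have "\<forall>i<n. \<exists>c. v $ i = (\<Sum>j<n. E (c j) * w $ j)" using assms base_span_iff by blast
  then obtain c where c: "\<And>i. i < n \<Longrightarrow> v $ i = (\<Sum>j<n. E (c i j) * w $ j)" by metis
  show thesis
    by (rule that[of "mat n n (\<lambda>(i, j). c i j)"]) (use c in auto)
qed

lemma compose_coefficients:
  assumes "P \<in> carrier_mat n n" "Q \<in> carrier_mat n n" "i < n"
    and "\<And>k. k < n \<Longrightarrow> y k = (\<Sum>j<n. E (Q $$ (k, j)) * w j)"
  shows "(\<Sum>k<n. E (P $$ (i, k)) * y k) = (\<Sum>j<n. E ((P * Q) $$ (i, j)) * w j)"
proof -
  have "(\<Sum>k<n. E (P $$ (i, k)) * y k) = (\<Sum>k<n. \<Sum>j<n. E (P $$ (i, k)) * (E (Q $$ (k, j)) * w j))"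
    using assms(4) by (simp add: sum_distrib_left)
  also have "\<dots> = (\<Sum>j<n. \<Sum>k<n. E (P $$ (i, k)) * (E (Q $$ (k, j)) * w j))" by (rule sum.swap)
  also have "\<dots> = (\<Sum>j<n. E ((P * Q) $$ (i, j)) * w j)"
    using assms(1-3)
    by (intro sum.cong refl)
      (simp add: scalar_prod_def lessThan_atLeast0 E.hom_sum E.hom_mult sum_distrib_right mult.assoc)
  finally show ?thesis .
qed

lemma coefficients_eq:
  assumes J: "module_ideal (base_span h v)" and v: "dim_vec v = n"
    and PQ: "P \<in> carrier_mat n n" "Q \<in> carrier_mat n n"
    and eq: "\<And>i. i < n \<Longrightarrow> (\<Sum>j<n. E (P $$ (i, j)) * v $ j) = (\<Sum>j<n. E (Q $$ (i, j)) * v $ j)"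
  shows "P = Q"
proof (rule eq_matI)
  fix i j assume "i < dim_row Q" "j < dim_col Q"
  then have ij: "i < n" "j < n" using PQ by auto
  have "(\<Sum>j<n. E (P $$ (i, j) - Q $$ (i, j)) * v $ j) = 0"
    using eq[OF ij(1)] by (simp add: E.hom_minus left_diff_distrib sum_subtractf)
  from spanning_independent[OF J v this ij(2)] show "P $$ (i, j) = Q $$ (i, j)" by simp
qed (use PQ in auto)

lemma same_span_similar:
  assumes \<alpha>: "\<alpha> \<in> carrier_mat n n" and v: "theta_eigenvector \<alpha> v"
    and \<beta>: "\<beta> \<in> carrier_mat n n" and w: "theta_eigenvector \<beta> w"
    and span: "base_span h v = base_span h w"
  shows "similar_mat \<beta> \<alpha>"
proof -
  note V = theta_eigenvectorD[OF \<alpha> v] and W = theta_eigenvectorD[OF \<beta> w]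
  note JV = span_module_ideal[OF \<alpha> v] and JW = span_module_ideal[OF \<beta> w]
  obtain P where P: "P \<in> carrier_mat n n" "\<And>i. i < n \<Longrightarrow> w $ i = (\<Sum>j<n. E (P $$ (i, j)) * v $ j)"
    using coefficient_matrix[OF V(1), of w] base_span_closed(4)[OF W(1)] span by metis
  obtain Q where Q: "Q \<in> carrier_mat n n" "\<And>i. i < n \<Longrightarrow> v $ i = (\<Sum>j<n. E (Q $$ (i, j)) * w $ j)"
    using coefficient_matrix[OF W(1), of v] base_span_closed(4)[OF V(1)] span by metis
  have one: "x $ i = (\<Sum>j<n. E (1\<^sub>m n $$ (i, j)) * x $ j)" if "i < n" for x :: "'l vec" and i
  proof -
    have "(\<Sum>j<n. E (1\<^sub>m n $$ (i, j)) * x $ j) = (\<Sum>j<n. if j = i then x $ i else 0)"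
      using that by (intro sum.cong) auto
    then show ?thesis using that by simp
  qed
  have PQ: "P * Q = 1\<^sub>m n"
  proof (rule coefficients_eq[OF JW W(1)])
    fix i assume i: "i < n"
    show "(\<Sum>j<n. E ((P * Q) $$ (i, j)) * w $ j) = (\<Sum>j<n. E (1\<^sub>m n $$ (i, j)) * w $ j)"
      using compose_coefficients[OF P(1) Q(1) i, of "\<lambda>i. v $ i" "\<lambda>i. w $ i"] Q(2) P(2)[OF i] one[OF i, of w]
      by metis
  qed (use P(1) Q(1) in simp_all)
  have QP: "Q * P = 1\<^sub>m n"
  proof (rule coefficients_eq[OF JV V(1)])
    fix i assume i: "i < n"
    show "(\<Sum>j<n. E ((Q * P) $$ (i, j)) * v $ j) = (\<Sum>j<n. E (1\<^sub>m n $$ (i, j)) * v $ j)"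
      using compose_coefficients[OF Q(1) P(1) i, of "\<lambda>i. w $ i" "\<lambda>i. v $ i"] P(2) Q(2)[OF i] one[OF i, of v]
      by metis
  qed (use P(1) Q(1) in simp_all)
  have "\<beta> * P = P * \<alpha>"
  proof (rule coefficients_eq[OF JV V(1)])
    fix i assume i: "i < n"
    have "(\<Sum>j<n. E ((\<beta> * P) $$ (i, j)) * v $ j) = (\<Sum>j<n. E (\<beta> $$ (i, j)) * w $ j)"
      using compose_coefficients[OF \<beta> P(1) i, of "\<lambda>i. w $ i" "\<lambda>i. v $ i"] P(2) by simp
    also have "\<dots> = \<theta> * w $ i" using W(4)[OF i] by simp
    also have "\<dots> = (\<Sum>j<n. E (P $$ (i, j)) * (\<theta> * v $ j))"
      unfolding P(2)[OF i] by (simp add: sum_distrib_left mult.left_commute)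
    also have "\<dots> = (\<Sum>j<n. E ((P * \<alpha>) $$ (i, j)) * v $ j)"
      by (rule compose_coefficients[OF P(1) \<alpha> i V(4)])
    finally show "(\<Sum>j<n. E ((\<beta> * P) $$ (i, j)) * v $ j) = (\<Sum>j<n. E ((P * \<alpha>) $$ (i, j)) * v $ j)" .
  qed (use P(1) \<alpha> \<beta> in simp_all)
  then have "P * \<alpha> * Q = \<beta> * (P * Q)"
    using assoc_mult_mat[OF \<beta> P(1) Q(1)] by simp
  then have "\<beta> = P * \<alpha> * Q" unfolding PQ using \<beta> by simp
  with PQ QP show ?thesis using \<alpha> \<beta> P(1) Q(1) by (intro similar_matI[of _ _ P Q n]) auto
qed

lemma ex_theta_eigenvector:
  assumes \<alpha>: "\<alpha> \<in> carrier_mat n n" and char: "char_poly \<alpha> = f"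
  obtains v where "theta_eigenvector \<alpha> v"
proof -
  have E\<alpha>: "map_mat E \<alpha> \<in> carrier_mat n n" using \<alpha> by simp
  have "poly (char_poly (map_mat E \<alpha>)) \<theta> = 0"
    using E.char_poly_hom[OF \<alpha>] char root by simp
  then obtain v where v: "eigenvector (map_mat E \<alpha>) v \<theta>"
    using eigenvalue_root_char_poly[OF E\<alpha>] unfolding eigenvalue_def by blast
  obtain N where N: "\<And>y. N y \<noteq> 0" "\<And>y. E (N y) * y \<in> B"
    using fraction unfolding adjoin_def by (metis rangeI)
  define M where "M = (\<Prod>i<n. N (v $ i))"
  have "M \<noteq> 0" unfolding M_def using N by simp
  have MB: "E M * v $ i \<in> B" if "i < n" for i
  proof -
    have "M = (\<Prod>j\<in>{..<n}-{i}. N (v $ j)) * N (v $ i)"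
      unfolding M_def using that by (simp add: prod.remove mult.commute)
    then show ?thesis using N(2)[of "v $ i"] adjoin_mult[OF adjoin_E] by (simp add: E.hom_mult mult.assoc)
  qed
  have v': "dim_vec v = n" "v \<noteq> 0\<^sub>v n" "map_mat E \<alpha> *\<^sub>v v = \<theta> \<cdot>\<^sub>v v"
    using v carrier_matD[OF E\<alpha>] unfolding eigenvector_def by auto
  have row: "\<theta> * v $ i = (\<Sum>j<n. E (\<alpha> $$ (i, j)) * v $ j)" if "i < n" for i
    using arg_cong[OF v'(3), of "\<lambda>x. x $ i"] that \<alpha> v'(1)
    by (simp add: scalar_prod_def lessThan_atLeast0)
  have "\<theta> * (E M \<cdot>\<^sub>v v) $ i = (\<Sum>j<n. E (\<alpha> $$ (i, j)) * (E M \<cdot>\<^sub>v v) $ j)" if "i < n" for i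
  proof -
    have "\<theta> * (E M \<cdot>\<^sub>v v) $ i = E M * (\<theta> * v $ i)" using that v'(1) by simp
    then show ?thesis unfolding row[OF that] using v'(1) by (simp add: sum_distrib_left mult.left_commute)
  qed
  moreover have "\<exists>i<n. (E M \<cdot>\<^sub>v v) $ i \<noteq> 0" using v'(1,2) \<open>M \<noteq> 0\<close> by (auto simp: vec_eq_iff)
  ultimately have "theta_eigenvector \<alpha> (E M \<cdot>\<^sub>v v)"
    unfolding theta_eigenvector_iff[OF \<alpha>] using v'(1) MB by simp
  then show thesis by (rule that)
qed

section \<open>The matrices \<open>C\<^sub>f(a, z)\<close> and the Latimer--MacDuffee correspondence\<close>

lemma theta_not_base: "\<theta> \<noteq> E z"
proof
  assume "\<theta> = E z"
  moreover have "ev [:- z, 1:] = \<theta> - E z" by (simp add: E.hom_uminus)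
  ultimately have "ev [:- z, 1:] = 0" by (metis diff_self)
  then show False using ev_eq_0[of "[:- z, 1:]"] n2 by simp
qed

lemma char_poly_of_eigenvector:
  assumes \<alpha>: "\<alpha> \<in> carrier_mat n n" and v: "theta_eigenvector \<alpha> v"
  shows "char_poly \<alpha> = f"
proof -
  have "eigenvalue (map_mat E \<alpha>) \<theta>"
    using v unfolding theta_eigenvector_def eigenvalue_def by blast
  then have "poly (char_poly (map_mat E \<alpha>)) \<theta> = 0"
    using eigenvalue_root_char_poly[of "map_mat E \<alpha>" n \<theta>] \<alpha> by simp
  then have "ev (char_poly \<alpha>) = 0" unfolding ev_def using E.char_poly_hom[OF \<alpha>] by simp
  then have 0: "ev (char_poly \<alpha> - f) = 0" by (simp add: ev_f)
  have deg: "degree (char_poly \<alpha>) = n" "coeff (char_poly \<alpha>) n = 1"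
    using degree_monic_char_poly[OF \<alpha>] by auto
  then have "degree (char_poly \<alpha> - f) \<le> n" using degree_f by (intro degree_diff_le) auto
  moreover have "coeff (char_poly \<alpha> - f) n = 0" using deg monic degree_f by simp
  ultimately have "degree (char_poly \<alpha> - f) < n"
    using n2 by (metis degree_0 le_neq_implies_less leading_coeff_0_iff not_numeral_le_zero gr0I)
  then have "char_poly \<alpha> - f = 0" using 0 by (rule ev_eq_0)
  then show ?thesis by simp
qed

definition C_vec :: "'a \<Rightarrow> 'a \<Rightarrow> 'l vec" where
  "C_vec a z = vec n (\<lambda>i. if i = n - 1 then E a else (\<theta> - E z) * \<theta> ^ i)"

lemma C_mat_carrier: "C_mat n f a z \<in> carrier_mat n n"
  by (simp add: C_mat_def)

lemma sum_split_last: "(\<Sum>i<n. g i) = (\<Sum>i<n-1. g i) + (g (n - 1) :: 'b :: comm_monoid_add)"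
  using n2 by (cases n) auto

lemma coeff_synthetic_div:
  assumes "i \<le> n - 1"
  shows "coeff (synthetic_div f z) (n - 1 - i) = - u_coeff n f z i"
  using assms
proof (induction i)
  have rec: "coeff f (Suc m) = coeff (synthetic_div f z) m - z * coeff (synthetic_div f z) (Suc m)" for m
    by (subst synthetic_div_correct'[of z f, symmetric]) simp
  {
    case 0
    have "coeff (synthetic_div f z) n = 0"
      using n2 by (intro coeff_eq_0) (simp add: degree_synthetic_div degree_f)
    then show ?case using rec[of "n - 1"] n2 monic degree_f by (simp add: u_coeff_def)
  next
    case (Suc i)
    then have S: "Suc (n - 1 - Suc i) = n - 1 - i" "n - 1 - i = n - Suc i" by auto
    have "- u_coeff n f z (Suc i) = z * - u_coeff n f z i + coeff f (n - Suc i)"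
    proof -
      have "(\<Sum>j = 1..i. coeff f (n - j) * z ^ (Suc i - j)) = z * (\<Sum>j = 1..i. coeff f (n - j) * z ^ (i - j))"
        by (auto simp: sum_distrib_left Suc_diff_le mult.left_commute intro!: sum.cong)
      then show ?thesis by (simp add: u_coeff_def algebra_simps)
    qed
    then show ?case using rec[of "n - 1 - Suc i"] Suc unfolding S by simp
  }
qed

lemma theta_minus_dvd_f: "(\<theta> - E z) * ev (synthetic_div f z) = - E (poly f z)"
proof -
  have "ev ([:- z, 1:] * synthetic_div f z + [:poly f z:]) = 0"
    unfolding synthetic_div_correct' by (rule ev_f)
  then show ?thesis by (simp add: E.hom_uminus eq_neg_iff_add_eq_0 algebra_simps)
qed

lemma C_mat_eigenvector:
  assumes a: "a \<noteq> 0" "a dvd poly f z"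
  shows "theta_eigenvector (C_mat n f a z) (C_vec a z)"
proof -
  have "\<theta> * C_vec a z $ i = (\<Sum>j<n. E (C_mat n f a z $$ (i, j)) * C_vec a z $ j)" if i: "i < n" for i
  proof -
    consider "i < n - 2" | "i = n - 2" | "i = n - 1" using i by linarith
    then show ?thesis
    proof cases
      case 1
      have "(\<Sum>j<n. E (C_mat n f a z $$ (i, j)) * C_vec a z $ j)
        = (\<Sum>j<n. if j = i + 1 then C_vec a z $ (i + 1) else 0)"
        using 1 by (intro sum.cong) (auto simp: C_mat_def)
      also have "\<dots> = \<theta> * C_vec a z $ i"
      proof -
        have "i + 1 < n" "i \<noteq> n - 1" "i + 1 \<noteq> n - 1" "i < n" using 1 by linarith+
        then show ?thesis by (simp add: C_vec_def)
      qed
      finally show ?thesis ..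
    next
      case 2
      define u where "u j = u_coeff n f z (n - 1 - j)" for j
      have "degree (synthetic_div f z) < n" using n2 by (simp add: degree_synthetic_div degree_f)
      then have "ev (synthetic_div f z) = (\<Sum>j<n. E (coeff (synthetic_div f z) j) * \<theta> ^ j)"
        by (subst poly_as_sum_lessThan) (auto simp: ev_sum)
      also have "\<dots> = \<theta> ^ (n - 1) + (\<Sum>j<n-1. - E (u j) * \<theta> ^ j)"
      proof -
        have "coeff (synthetic_div f z) j = - u j" if "j \<le> n - 1" for j
        proof -
          have "n - 1 - (n - 1 - j) = j" using that by simp
          then show ?thesis unfolding u_def using coeff_synthetic_div[of "n - 1 - j" z] by simp
        qed
        moreover have "u (n - 1) = - 1" by (simp add: u_def u_coeff_def)
        ultimately show ?thesis unfolding sum_split_last by (simp add: E.hom_uminus)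
      qed
      finally have q: "(\<Sum>j<n-1. E (u j) * \<theta> ^ j) = \<theta> ^ (n - 1) - ev (synthetic_div f z)"
        by (simp add: sum_negf)
      have "(\<Sum>j<n. E (C_mat n f a z $$ (i, j)) * C_vec a z $ j)
        = (\<Sum>j<n-1. E (u j) * ((\<theta> - E z) * \<theta> ^ j)) + E (- (poly f z div a)) * E a"
        unfolding sum_split_last using 2 n2 by (simp add: C_mat_def C_vec_def u_def)
      also have "E (- (poly f z div a)) * E a = - E (poly f z)"
        using a by (auto simp flip: E.hom_mult simp add: E.hom_uminus elim!: dvdE)
      also have "(\<Sum>j<n-1. E (u j) * ((\<theta> - E z) * \<theta> ^ j)) = (\<theta> - E z) * (\<Sum>j<n-1. E (u j) * \<theta> ^ j)"
        by (simp add: sum_distrib_left mult.left_commute)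
      also have "\<dots> + - E (poly f z) = (\<theta> - E z) * \<theta> ^ (n - 1)"
        unfolding q using theta_minus_dvd_f[of z] by (simp add: right_diff_distrib)
      also have "n - 1 = Suc i" using 2 n2 by simp
      also have "(\<theta> - E z) * \<theta> ^ Suc i = \<theta> * C_vec a z $ i"
      proof -
        have "i \<noteq> n - 1" "i < n" using 2 n2 by linarith+
        then show ?thesis by (simp add: C_vec_def)
      qed
      finally show ?thesis ..
    next
      case 3
      have "(\<Sum>j<n-1. E (C_mat n f a z $$ (i, j)) * C_vec a z $ j) = (\<Sum>j<n-1. if j = 0 then E a * C_vec a z $ 0 else 0)"
        using 3 n2 by (intro sum.cong) (auto simp: C_mat_def)
      also have "\<dots> = E a * (\<theta> - E z)" using n2 by (simp add: C_vec_def)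
      finally have "(\<Sum>j<n. E (C_mat n f a z $$ (i, j)) * C_vec a z $ j)
        = E a * (\<theta> - E z) + E (C_mat n f a z $$ (i, n - 1)) * C_vec a z $ (n - 1)"
        unfolding sum_split_last by simp
      moreover have "C_mat n f a z $$ (i, n - 1) = z"
        using 3 n2 by (simp add: C_mat_def) linarith
      moreover have "C_vec a z $ (n - 1) = E a" using n2 by (simp add: C_vec_def)
      ultimately show ?thesis using 3 by (simp add: algebra_simps)
    qed
  qed
  moreover have "C_vec a z $ i \<in> B" if "i < n" for i
    using that by (auto simp: C_vec_def intro!: adjoin_closed)
  moreover have "C_vec a z $ (n - 1) \<noteq> 0" "n - 1 < n" using n2 a(1) by (auto simp: C_vec_def)
  ultimately show ?thesis unfolding theta_eigenvector_iff[OF C_mat_carrier]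
    by (auto simp: C_vec_def)
qed

lemma C_vec_span_iff:
  "y \<in> base_span h (C_vec a z) \<longleftrightarrow> (\<exists>q c. degree q < n - 1 \<and> y = (\<theta> - E z) * ev q + E (a * c))"
proof -
  have eq: "(\<Sum>i<n. E (c i) * C_vec a z $ i) = (\<theta> - E z) * (\<Sum>i<n-1. E (c i) * \<theta> ^ i) + E (a * c (n - 1))" for c
    unfolding sum_split_last using n2
    by (simp add: C_vec_def sum_distrib_left mult.left_commute E.hom_mult mult.commute[of "E a"])
  have dim: "dim_vec (C_vec a z) = n" by (simp add: C_vec_def)
  show ?thesis unfolding base_span_iff[OF dim] eq
  proof (intro iffI; elim exE conjE)
    fix c assume "y = (\<theta> - E z) * (\<Sum>i<n-1. E (c i) * \<theta> ^ i) + E (a * c (n - 1))"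
    moreover have "degree (\<Sum>i<n-1. monom (c i) i) \<le> n - 2"
      by (intro degree_sum_le) (auto intro: degree_monom_le[THEN le_trans])
    then have "degree (\<Sum>i<n-1. monom (c i) i) < n - 1" using n2 by simp
    ultimately show "\<exists>q c. degree q < n - 1 \<and> y = (\<theta> - E z) * ev q + E (a * c)"
      by (intro exI[of _ "\<Sum>i<n-1. monom (c i) i"] exI[of _ "c (n - 1)"]) (simp add: ev_sum)
  next
    fix q c assume q: "degree q < n - 1" "y = (\<theta> - E z) * ev q + E (a * c)"
    have "ev q = (\<Sum>i<n-1. E (coeff q i) * \<theta> ^ i)"
      by (subst poly_as_sum_lessThan[OF q(1)]) (simp add: ev_sum)
    then show "\<exists>c. y = (\<theta> - E z) * (\<Sum>i<n-1. E (c i) * \<theta> ^ i) + E (a * c (n - 1))"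
      using q by (intro exI[of _ "\<lambda>i. if i = n - 1 then c else coeff q i"]) simp
  qed
qed

lemma ideal_class_iff:
  "J \<in> ideal_class h \<theta> I \<longleftrightarrow>
    module_ideal J \<and> (\<exists>x\<in>B-{0}. \<exists>y\<in>B-{0}. (\<lambda>t. x * t) ` I = (\<lambda>t. y * t) ` J)"
  unfolding ideal_class_def using ideal_iff[of J] by auto

lemma ideal_class_self: "module_ideal J \<Longrightarrow> J \<in> ideal_class h \<theta> J"
  unfolding ideal_class_iff using adjoin_1 by (intro conjI bexI[of _ 1]) auto

lemma image_mult_mult: "(\<lambda>t. (x * y) * t) ` S = (\<lambda>t. x * t) ` (\<lambda>t. y * t) ` (S :: 'l set)"
  by (simp add: image_image mult.assoc)

lemma ideal_class_eqI:
  assumes x: "x \<in> B" "x \<noteq> 0" and y: "y \<in> B" "y \<noteq> 0" and eq: "(\<lambda>t. x * t) ` I = (\<lambda>t. y * t) ` J"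
  shows "ideal_class h \<theta> I = ideal_class h \<theta> J"
proof -
  have "\<exists>x\<in>B-{0}. \<exists>y\<in>B-{0}. (\<lambda>t. x * t) ` J = (\<lambda>t. y * t) ` K"
    if IK: "\<exists>x\<in>B-{0}. \<exists>y\<in>B-{0}. (\<lambda>t. x * t) ` I = (\<lambda>t. y * t) ` K"
      and x: "x \<in> B - {0}" and y: "y \<in> B - {0}" and eq: "(\<lambda>t. x * t) ` I = (\<lambda>t. y * t) ` J"
    for I J K x y
  proof -
    obtain s t where st: "s \<in> B - {0}" "t \<in> B - {0}" "(\<lambda>u. s * u) ` I = (\<lambda>u. t * u) ` K"
      using IK by blast
    have "(\<lambda>u. (s * y) * u) ` J = (\<lambda>u. (x * s) * u) ` I"
      unfolding image_mult_mult eq[symmetric] by (simp add: image_image mult.left_commute)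
    also have "\<dots> = (\<lambda>u. (x * t) * u) ` K" unfolding image_mult_mult st(3) ..
    finally show ?thesis using st(1,2) x y
      by (intro bexI[of _ "s * y"] bexI[of _ "x * t"]) (auto intro: adjoin_mult)
  qed
  note transfer = this
  have xy: "x \<in> B - {0}" "y \<in> B - {0}" using x y by auto
  have iff: "(\<exists>x\<in>B-{0}. \<exists>y\<in>B-{0}. (\<lambda>t. x * t) ` I = (\<lambda>t. y * t) ` K) \<longleftrightarrow>
      (\<exists>x\<in>B-{0}. \<exists>y\<in>B-{0}. (\<lambda>t. x * t) ` J = (\<lambda>t. y * t) ` K)" for K
    by (rule iffI, erule transfer[OF _ xy eq], erule transfer[OF _ xy(2,1) eq[symmetric]])
  show ?thesis
  proof (rule Set.set_eqI)
    fix K show "K \<in> ideal_class h \<theta> I \<longleftrightarrow> K \<in> ideal_class h \<theta> J"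
      unfolding ideal_class_iff iff[of K] ..
  qed
qed

lemma similar_eigenvector:
  assumes \<alpha>: "\<alpha> \<in> carrier_mat n n" and v: "theta_eigenvector \<alpha> v"
    and \<beta>: "\<beta> \<in> carrier_mat n n" and sim: "similar_mat \<beta> \<alpha>"
  obtains w where "theta_eigenvector \<beta> w" "base_span h w = base_span h v"
proof -
  note V = theta_eigenvectorD[OF \<alpha> v] and J = span_module_ideal[OF \<alpha> v]
  obtain P Q where "similar_mat_wit \<beta> \<alpha> P Q" using sim unfolding similar_mat_def by blast
  then have PQ: "P \<in> carrier_mat n n" "Q \<in> carrier_mat n n" "P * Q = 1\<^sub>m n" "Q * P = 1\<^sub>m n"
    "\<beta> = P * \<alpha> * Q"
    using \<beta> unfolding similar_mat_wit_def Let_def by auto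
  define w where "w = vec n (\<lambda>i. \<Sum>j<n. E (P $$ (i, j)) * v $ j)"
  have w: "dim_vec w = n" "\<And>i. i < n \<Longrightarrow> w $ i = (\<Sum>j<n. E (P $$ (i, j)) * v $ j)"
    by (auto simp: w_def)
  have Qw: "v $ i = (\<Sum>j<n. E (Q $$ (i, j)) * w $ j)" if i: "i < n" for i
  proof -
    have "(\<Sum>k<n. E (Q $$ (i, k)) * w $ k) = (\<Sum>j<n. E (1\<^sub>m n $$ (i, j)) * v $ j)"
      using compose_coefficients[OF PQ(2,1) i, of "\<lambda>i. w $ i" "\<lambda>i. v $ i"] w(2) PQ(4) by simp
    also have "\<dots> = (\<Sum>j<n. if j = i then v $ i else 0)" using i by (intro sum.cong) auto
    finally show ?thesis using i by simp
  qed
  have wJ: "w $ i \<in> base_span h v" if "i < n" for i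
    unfolding base_span_iff[OF V(1)] w(2)[OF that] by (rule exI[of _ "\<lambda>j. P $$ (i, j)"]) (rule refl)
  have span: "base_span h w = base_span h v"
  proof
    show "base_span h w \<subseteq> base_span h v" using base_span_mono[OF w(1) V(1) wJ] .
    have "v $ i \<in> base_span h w" if "i < n" for i
      unfolding base_span_iff[OF w(1)] Qw[OF that] by (rule exI[of _ "\<lambda>j. Q $$ (i, j)"]) (rule refl)
    then show "base_span h v \<subseteq> base_span h w" using base_span_mono[OF V(1) w(1)] by blast
  qed
  have "\<beta> * P = P * \<alpha>"
  proof -
    have "\<beta> * P = P * \<alpha> * (Q * P)" unfolding PQ(5) using PQ(1,2) \<alpha>
      by (intro assoc_mult_mat[of _ n n _ n _ n]) auto
    then show ?thesis unfolding PQ(4) using PQ(1) \<alpha> by simp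
  qed
  have "\<theta> * w $ i = (\<Sum>j<n. E (\<beta> $$ (i, j)) * w $ j)" if i: "i < n" for i
  proof -
    have "\<theta> * w $ i = (\<Sum>j<n. E (P $$ (i, j)) * (\<theta> * v $ j))"
      unfolding w(2)[OF i] by (simp add: sum_distrib_left mult.left_commute)
    also have "\<dots> = (\<Sum>j<n. E ((\<beta> * P) $$ (i, j)) * v $ j)"
      unfolding \<open>\<beta> * P = P * \<alpha>\<close> by (rule compose_coefficients[OF PQ(1) \<alpha> i V(4)])
    also have "\<dots> = (\<Sum>j<n. E (\<beta> $$ (i, j)) * w $ j)"
      using compose_coefficients[OF \<beta> PQ(1) i, of "\<lambda>i. w $ i" "\<lambda>i. v $ i"] w(2) by simp
    finally show ?thesis .
  qed
  moreover have "\<exists>i<n. w $ i \<noteq> 0"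
  proof (rule ccontr)
    assume "\<not> (\<exists>i<n. w $ i \<noteq> 0)"
    then have "v $ i = 0" if "i < n" for i using Qw[OF that] by simp
    then show False using V(3) by blast
  qed
  ultimately have "theta_eigenvector \<beta> w"
    unfolding theta_eigenvector_iff[OF \<beta>] using w(1) wJ module_idealD(1)[OF J] by blast
  then show thesis using span that by blast
qed

lemma latimer_macduffee_eq:
  assumes \<alpha>: "\<alpha> \<in> carrier_mat n n" and v: "theta_eigenvector \<alpha> v"
  shows "latimer_macduffee h \<theta> (similarity_class n \<alpha>) = ideal_class h \<theta> (base_span h v)"
  unfolding latimer_macduffee_def
proof (rule the_equality)
  have "\<alpha> \<in> similarity_class n \<alpha>" using \<alpha> similar_mat_refl by (auto simp: similarity_class_def)
  then show "\<exists>\<beta>\<in>similarity_class n \<alpha>. \<exists>w. set\<^sub>v w \<subseteq> B \<and> eigenvector (map_mat E \<beta>) w \<theta> \<and>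
      ideal_class h \<theta> (base_span h v) = ideal_class h \<theta> (base_span h w)"
    using v unfolding theta_eigenvector_def by blast
next
  fix C assume "\<exists>\<beta>\<in>similarity_class n \<alpha>. \<exists>w. set\<^sub>v w \<subseteq> B \<and> eigenvector (map_mat E \<beta>) w \<theta> \<and>
      C = ideal_class h \<theta> (base_span h w)"
  then obtain \<beta> w where \<beta>: "\<beta> \<in> carrier_mat n n" "similar_mat \<beta> \<alpha>" "theta_eigenvector \<beta> w"
    and C: "C = ideal_class h \<theta> (base_span h w)"
    unfolding similarity_class_def theta_eigenvector_def by blast
  obtain u where u: "theta_eigenvector \<beta> u" "base_span h u = base_span h v"
    using similar_eigenvector[OF \<alpha> v \<beta>(1,2)] by blast
  obtain x y where xy: "x \<in> B" "y \<in> B" "x \<noteq> 0" "y \<noteq> 0" "x \<cdot>\<^sub>v w = y \<cdot>\<^sub>v u"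
    using eigenvectors_proportional[OF \<beta>(1,3) u(1)] by blast
  have "(\<lambda>t. x * t) ` base_span h w = (\<lambda>t. y * t) ` base_span h u"
    using base_span_smult[of w x] base_span_smult[of u y] xy(5)
      theta_eigenvectorD(1)[OF \<beta>(1,3)] theta_eigenvectorD(1)[OF \<beta>(1) u(1)] by simp
  from ideal_class_eqI[OF xy(1,3,2,4) this] show "C = ideal_class h \<theta> (base_span h v)"
    unfolding C u(2) .
qed

lemma similarity_class_eqI:
  assumes "similar_mat \<beta> \<alpha>"
  shows "similarity_class n \<beta> = similarity_class n \<alpha>"
  unfolding similarity_class_def using assms similar_mat_sym similar_mat_trans by blast

lemma latimer_macduffee_inj: "inj_on (latimer_macduffee h \<theta>) (similarity_classes n f)"
proof (rule inj_onI)
  fix S T assume "S \<in> similarity_classes n f" "T \<in> similarity_classes n f"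
    and eq: "latimer_macduffee h \<theta> S = latimer_macduffee h \<theta> T"
  then obtain \<alpha> \<beta> where \<alpha>: "\<alpha> \<in> carrier_mat n n" "char_poly \<alpha> = f" "S = similarity_class n \<alpha>"
    and \<beta>: "\<beta> \<in> carrier_mat n n" "char_poly \<beta> = f" "T = similarity_class n \<beta>"
    unfolding similarity_classes_def by blast
  obtain v where v: "theta_eigenvector \<alpha> v" using ex_theta_eigenvector[OF \<alpha>(1,2)] .
  obtain w where w: "theta_eigenvector \<beta> w" using ex_theta_eigenvector[OF \<beta>(1,2)] .
  have "base_span h w \<in> ideal_class h \<theta> (base_span h v)"
    using eq ideal_class_self[OF span_module_ideal[OF \<beta>(1) w]]
    unfolding \<alpha>(3) \<beta>(3) latimer_macduffee_eq[OF \<alpha>(1) v] latimer_macduffee_eq[OF \<beta>(1) w] by simp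
  then obtain x y where xy: "x \<in> B" "x \<noteq> 0" "y \<in> B" "y \<noteq> 0"
    "(\<lambda>t. x * t) ` base_span h v = (\<lambda>t. y * t) ` base_span h w"
    unfolding ideal_class_iff by blast
  then have "base_span h (x \<cdot>\<^sub>v v) = base_span h (y \<cdot>\<^sub>v w)"
    using base_span_smult theta_eigenvectorD(1) \<alpha>(1) v \<beta>(1) w by metis
  then have "similar_mat \<beta> \<alpha>"
    using same_span_similar[OF \<alpha>(1) eigenvector_smult[OF \<alpha>(1) v xy(1,2)] \<beta>(1) eigenvector_smult[OF \<beta>(1) w xy(3,4)]]
    by blast
  then show "S = T" unfolding \<alpha>(3) \<beta>(3) using similarity_class_eqI by metis
qed

lemma degree_one_ideal_C_vec:
  assumes b: "degree_one_ideal h \<theta> b"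
  obtains a z where "a \<noteq> 0" "a dvd poly f z" "b = base_span h (C_vec a z)"
proof -
  have sum: "\<exists>c. \<exists>x\<in>b. y = E c + x" if "y \<in> B" for y
  proof -
    have "y \<in> range E <+>\<^bsub>adjoin_ring h \<theta>\<^esub> b" using b that unfolding degree_one_ideal_def by simp
    then show ?thesis by (auto simp: set_add_def set_mult_def adjoin_ring_def)
  qed
  have "b \<noteq> {0}" using sum[OF adjoin_theta] theta_not_base by (metis add.right_neutral singletonD)
  then have J: "module_ideal b" using b unfolding degree_one_ideal_def ideal_iff[symmetric] by blast
  note JD = module_idealD[OF J]
  obtain a where a: "{c. E c \<in> b} = {c. a dvd c}"
    by (rule ideal_principal[of "{c. E c \<in> b}"]) (auto simp: E.hom_add E.hom_mult intro: JD)
  have "a \<noteq> 0" using module_ideal_contains_base[OF J] a by (metis dvd_0_left_iff mem_Collect_eq)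
  obtain z x where z: "x \<in> b" "\<theta> = E z + x" using sum[OF adjoin_theta] by blast
  then have zb: "\<theta> - E z \<in> b" by simp
  have fz: "a dvd poly f z"
  proof -
    have "E (poly f z) = - (ev (synthetic_div f z) * (\<theta> - E z))"
      using theta_minus_dvd_f[of z] by (simp add: mult.commute)
    also have "\<dots> \<in> b" by (intro JD(6,4) ev_in zb)
    finally show ?thesis using a by blast
  qed
  have "y \<in> b \<longleftrightarrow> y \<in> base_span h (C_vec a z)" for y
  proof
    assume y: "y \<in> b"
    obtain g where g: "degree g < n" "y = ev g" using adjoin_repr JD(1) y by blast
    have "ev g = ev ([:- z, 1:] * synthetic_div g z + [:poly g z:])"
      by (simp only: synthetic_div_correct')
    then have eq: "y = (\<theta> - E z) * ev (synthetic_div g z) + E (poly g z)"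
      using g(2) by (simp add: E.hom_uminus algebra_simps)
    then have "E (poly g z) = y - ev (synthetic_div g z) * (\<theta> - E z)" by (simp add: mult.commute)
    also have "\<dots> \<in> b" by (intro JD(5,4) ev_in zb y)
    finally have "a dvd poly g z" using a by blast
    then obtain c where c: "poly g z = a * c" by (elim dvdE)
    have "degree (synthetic_div g z) < n - 1" using g n2 by (simp add: degree_synthetic_div)
    then show "y \<in> base_span h (C_vec a z)" unfolding C_vec_span_iff using eq c by auto
  next
    assume "y \<in> base_span h (C_vec a z)"
    then obtain q c where y: "y = (\<theta> - E z) * ev q + E (a * c)" unfolding C_vec_span_iff by blast
    have "a * c \<in> {c. E c \<in> b}" unfolding a by simp
    then have "ev q * (\<theta> - E z) + E (a * c) \<in> b" by (intro JD(3,4) ev_in zb) simp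
    then show "y \<in> b" unfolding y by (simp only: mult.commute)
  qed
  then have "b = base_span h (C_vec a z)" by (rule Set.set_eqI)
  then show thesis using that \<open>a \<noteq> 0\<close> fz by blast
qed

theorem corresponding_C_mat:
  assumes "degree_one_ideal h \<theta> b"
  shows "\<exists>a z. a dvd poly f z \<and>
    C_mat n f a z \<in> corresponding_similarity_class h \<theta> n f (ideal_class h \<theta> b)"
proof -
  obtain a z where az: "a \<noteq> 0" "a dvd poly f z" "b = base_span h (C_vec a z)"
    using degree_one_ideal_C_vec[OF assms] .
  have ev: "theta_eigenvector (C_mat n f a z) (C_vec a z)" using C_mat_eigenvector az by blast
  have "latimer_macduffee h \<theta> (similarity_class n (C_mat n f a z)) = ideal_class h \<theta> b"
    unfolding az(3) by (rule latimer_macduffee_eq[OF C_mat_carrier ev])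
  moreover have "similarity_class n (C_mat n f a z) \<in> similarity_classes n f"
    unfolding similarity_classes_def using C_mat_carrier char_poly_of_eigenvector[OF C_mat_carrier ev] by blast
  ultimately have "corresponding_similarity_class h \<theta> n f (ideal_class h \<theta> b)
      = similarity_class n (C_mat n f a z)"
    unfolding corresponding_similarity_class_def by (intro the_inv_into_f_eq latimer_macduffee_inj)
  moreover have "C_mat n f a z \<in> similarity_class n (C_mat n f a z)"
    using C_mat_carrier similar_mat_refl by (auto simp: similarity_class_def)
  ultimately show ?thesis using az(2) by blast
qed

section \<open>Purity\<close>

definition mul :: "'a \<Rightarrow> 'l set \<Rightarrow> 'l set" where
  "mul c S = (\<lambda>t. E c * t) ` S"

lemma mul_iff: "y \<in> mul c S \<longleftrightarrow> (\<exists>t\<in>S. y = E c * t)"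
  by (auto simp: mul_def)

lemma module_ideal_adjoin: "module_ideal B"
  unfolding module_ideal_def using adjoin_1 by (auto intro: adjoin_closed)

lemma mul_closed:
  assumes J: "module_ideal J"
  shows "y \<in> mul c J \<Longrightarrow> y' \<in> mul c J \<Longrightarrow> y + y' \<in> mul c J"
    "y \<in> mul c J \<Longrightarrow> y' \<in> mul c J \<Longrightarrow> y - y' \<in> mul c J"
    "b \<in> B \<Longrightarrow> y \<in> mul c J \<Longrightarrow> b * y \<in> mul c J"
    "y \<in> J \<Longrightarrow> E c * y \<in> mul c J"
    "b \<in> mul c B \<Longrightarrow> y \<in> J \<Longrightarrow> b * y \<in> mul c J"
    "c dvd d \<Longrightarrow> y \<in> mul d J \<Longrightarrow> y \<in> mul c J"
    "y \<in> mul c J \<Longrightarrow> y \<in> mul c B"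
    "y \<in> mul c J \<Longrightarrow> y \<in> J"
proof -
  note D = module_idealD[OF J]
  show "y \<in> mul c J \<Longrightarrow> y' \<in> mul c J \<Longrightarrow> y + y' \<in> mul c J"
    unfolding mul_iff by (metis D(3) distrib_left)
  show "y \<in> mul c J \<Longrightarrow> y' \<in> mul c J \<Longrightarrow> y - y' \<in> mul c J"
    unfolding mul_iff by (metis D(5) right_diff_distrib)
  show "b \<in> B \<Longrightarrow> y \<in> mul c J \<Longrightarrow> b * y \<in> mul c J"
    unfolding mul_iff by (metis D(4) mult.left_commute)
  show "y \<in> J \<Longrightarrow> E c * y \<in> mul c J" unfolding mul_iff by blast
  show "b \<in> mul c B \<Longrightarrow> y \<in> J \<Longrightarrow> b * y \<in> mul c J"
    unfolding mul_iff by (metis D(4) mult.assoc)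
  show "c dvd d \<Longrightarrow> y \<in> mul d J \<Longrightarrow> y \<in> mul c J"
    unfolding mul_iff by (elim dvdE) (metis D(7) E.hom_mult mult.assoc)
  show "y \<in> mul c J \<Longrightarrow> y \<in> mul c B" unfolding mul_iff using D(1) by blast
  show "y \<in> mul c J \<Longrightarrow> y \<in> J" unfolding mul_iff using D(7) by blast
qed

lemmas mulB_closed = mul_closed[OF module_ideal_adjoin]

lemma mulB_cancel:
  assumes "irreducible p" "\<not> p dvd c" "y \<in> B" "E c * y \<in> mul p B"
  shows "y \<in> mul p B"
proof -
  obtain u v where uv: "u * c + v * p = 1" using irreducible_coprime assms(1,2) by blast
  have "y = E (u * c + v * p) * y" unfolding uv by simp
  also have "\<dots> = E u * (E c * y) + E p * (E v * y)" by (simp add: E.hom_add E.hom_mult algebra_simps)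
  also have "\<dots> \<in> mul p B"
    by (intro mulB_closed(1,3,4) assms adjoin_closed)
  finally show ?thesis .
qed

definition good :: "'l set \<Rightarrow> 'a \<Rightarrow> 'l \<Rightarrow> bool" where
  "good J p x \<longleftrightarrow> (\<forall>e\<in>B. e * x \<in> mul p J \<longrightarrow> e \<in> mul p B)"

lemma good_cong:
  assumes J: "module_ideal J" and good: "good J p x" and "x' - x \<in> mul p J"
  shows "good J p x'"
  unfolding good_def
proof (intro ballI impI)
  fix e assume e: "e \<in> B" "e * x' \<in> mul p J"
  have "e * x = e * x' - e * (x' - x)" by (simp add: algebra_simps)
  also have "\<dots> \<in> mul p J" by (intro mul_closed(2,3)[OF J] assms(3) e)
  finally show "e \<in> mul p B" using good e(1) unfolding good_def by blast
qed

lemma good_base: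
  assumes J: "module_ideal J" and p: "irreducible p" "\<not> p dvd N"
  shows "good J p (E N)"
  unfolding good_def
  using mul_closed(7)[OF J] mulB_cancel[OF p] by (metis mult.commute)

definition polynomial_family :: "('a \<Rightarrow> 'l) \<Rightarrow> bool" where
  "polynomial_family \<phi> \<longleftrightarrow> (\<exists>w. \<forall>s. \<phi> s = (\<Sum>i<n. E (poly (w i) s) * \<theta> ^ i))"

lemma polynomial_family_add:
  assumes "polynomial_family \<phi>" "polynomial_family \<psi>"
  shows "polynomial_family (\<lambda>s. \<phi> s + \<psi> s)"
proof -
  obtain w w' where "\<And>s. \<phi> s = (\<Sum>i<n. E (poly (w i) s) * \<theta> ^ i)"
    "\<And>s. \<psi> s = (\<Sum>i<n. E (poly (w' i) s) * \<theta> ^ i)"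
    using assms unfolding polynomial_family_def by blast
  then show ?thesis unfolding polynomial_family_def
    by (intro exI[of _ "\<lambda>i. w i + w' i"]) (simp add: E.hom_add distrib_right sum.distrib)
qed

lemma polynomial_family_scale:
  assumes "polynomial_family \<phi>"
  shows "polynomial_family (\<lambda>s. E (poly c s) * \<phi> s)"
proof -
  obtain w where "\<And>s. \<phi> s = (\<Sum>i<n. E (poly (w i) s) * \<theta> ^ i)"
    using assms unfolding polynomial_family_def by blast
  then show ?thesis unfolding polynomial_family_def
    by (intro exI[of _ "\<lambda>i. c * w i"]) (simp add: E.hom_mult sum_distrib_left mult.assoc)
qed

lemma polynomial_family_mult:
  assumes "polynomial_family \<phi>" "b \<in> B"
  shows "polynomial_family (\<lambda>s. b * \<phi> s)"
proof -
  obtain w where w: "\<And>s. \<phi> s = (\<Sum>i<n. E (poly (w i) s) * \<theta> ^ i)"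
    using assms unfolding polynomial_family_def by blast
  have "\<exists>r. b * \<theta> ^ i = (\<Sum>k<n. E (r k) * \<theta> ^ k)" for i
    using adjoin_coordinates[of "b * \<theta> ^ i"] assms(2) adjoin_closed by metis
  then obtain r where r: "\<And>i. b * \<theta> ^ i = (\<Sum>k<n. E (r i k) * \<theta> ^ k)" by metis
  have "b * \<phi> s = (\<Sum>k<n. E (poly (\<Sum>i<n. smult (r i k) (w i)) s) * \<theta> ^ k)" for s
  proof -
    have "b * \<phi> s = (\<Sum>i<n. E (poly (w i) s) * (b * \<theta> ^ i))"
      unfolding w by (simp add: sum_distrib_left mult.left_commute)
    also have "\<dots> = (\<Sum>i<n. \<Sum>k<n. E (poly (w i) s) * (E (r i k) * \<theta> ^ k))"
      unfolding r by (simp add: sum_distrib_left)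
    also have "\<dots> = (\<Sum>k<n. \<Sum>i<n. E (poly (w i) s) * (E (r i k) * \<theta> ^ k))" by (rule sum.swap)
    also have "\<dots> = (\<Sum>k<n. E (poly (\<Sum>i<n. smult (r i k) (w i)) s) * \<theta> ^ k)"
      by (simp add: poly_sum E.hom_sum E.hom_mult sum_distrib_left sum_distrib_right mult_ac)
    finally show ?thesis .
  qed
  then show ?thesis unfolding polynomial_family_def
    by (intro exI[of _ "\<lambda>k. \<Sum>i<n. smult (r i k) (w i)"]) blast
qed

text \<open>
  The coordinates of the powers of \<open>s v\<^sub>0 + N\<^sup>2 \<theta>\<close> form a matrix whose determinant is a polynomial
  in \<open>s\<close> that does not vanish at \<open>0\<close>.
\<close>

lemma generic_element:
  assumes v0: "v0 \<in> B" and N: "N \<noteq> 0" "\<not> N dvd 1"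
  shows "\<exists>s R q. N dvd s - 1 \<and> R \<noteq> 0 \<and>
    E R * \<theta> = poly (map_poly E q) (E s * v0 + E (N ^ 2) * \<theta>)"
proof -
  define V where "V s = E s * v0 + E (N ^ 2) * \<theta>" for s
  have fam: "polynomial_family (\<lambda>s. V s ^ j)" for j
  proof (induction j)
    case 0
    have "(\<Sum>i<n. E (poly (if i = 0 then 1 else 0) s) * \<theta> ^ i) = (\<Sum>i<n. if i = 0 then 1 else 0)" for s
      by (intro sum.cong) auto
    then have "(1 :: 'l) = (\<Sum>i<n. E (poly (if i = 0 then 1 else 0) s) * \<theta> ^ i)" for s using n2 by simp
    then show ?case unfolding polynomial_family_def power_0
      by (intro exI[of _ "\<lambda>i. if i = 0 then 1 else 0"] allI)
  next
    case (Suc j)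
    have "polynomial_family (\<lambda>s. E (poly [:0, 1:] s) * (v0 * V s ^ j) + (E (N ^ 2) * \<theta>) * V s ^ j)"
      by (intro polynomial_family_add polynomial_family_scale polynomial_family_mult Suc v0 adjoin_closed)
    then show ?case by (simp add: V_def distrib_right mult.assoc)
  qed
  then obtain w where w: "\<And>j s. V s ^ j = (\<Sum>i<n. E (poly (w j i) s) * \<theta> ^ i)"
    unfolding polynomial_family_def by metis
  define W where "W = mat n n (\<lambda>(j, i). w j i)"
  define Ws where "Ws s = map_mat (\<lambda>p. poly p s) W" for s
  have Ws: "Ws s \<in> carrier_mat n n" for s by (simp add: Ws_def W_def)
  have det: "det (Ws s) = poly (det W) s" for s
  proof -
    have "comm_ring_hom (\<lambda>p. poly p s)" by unfold_locales auto
    then show ?thesis unfolding Ws_def by (rule comm_ring_hom.hom_det)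
  qed
  have Ws0: "Ws 0 $$ (j, i) = (if i = j then N ^ (2 * j) else 0)" if ij: "i < n" "j < n" for i j
  proof -
    have "(\<Sum>i<n. E (poly (w j i) 0) * \<theta> ^ i) = (\<Sum>i<n. E (if i = j then N ^ (2 * j) else 0) * \<theta> ^ i)"
    proof -
      have "(\<Sum>i<n. E (if i = j then N ^ (2 * j) else 0) * \<theta> ^ i) = (\<Sum>i<n. if i = j then E (N ^ (2 * j)) * \<theta> ^ j else 0)"
        by (intro sum.cong) auto
      also have "\<dots> = V 0 ^ j"
        using ij by (simp add: V_def power_mult_distrib power_mult E.hom_power)
      finally show ?thesis using w[of 0 j] by simp
    qed
    from coordinates_unique[OF this ij(1)] show ?thesis using ij by (simp add: Ws_def W_def)
  qed
  have "det (Ws 0) = prod_list (diag_mat (Ws 0))"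
    using Ws Ws0 by (intro det_upper_triangular[of _ n] upper_triangularI) (auto simp: Ws_def W_def)
  moreover have "0 \<notin> set (diag_mat (Ws 0))"
    using Ws0 N(1) Ws[of 0] by (auto simp: diag_mat_def)
  ultimately have "det (Ws 0) \<noteq> 0" by (simp add: prod_list_zero_iff)
  then have "det W \<noteq> 0" unfolding det by auto
  then have "finite {s. poly (det W) s = 0}" by (rule poly_roots_finite)
  moreover have "inj (\<lambda>k. 1 + N ^ Suc k)"
  proof (rule linorder_injI)
    fix i j :: nat assume "i < j"
    then obtain d where "j = i + Suc d" by (metis less_imp_Suc_add add_Suc_right)
    show "1 + N ^ Suc i \<noteq> 1 + N ^ Suc j"
    proof
      assume "1 + N ^ Suc i = 1 + N ^ Suc j"
      then have "N ^ Suc i * 1 = N ^ Suc i * N ^ Suc d"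
        using \<open>j = i + Suc d\<close> by (simp add: power_add mult_ac)
      then have "1 = N ^ Suc d" using N(1) by (metis mult_left_cancel power_not_zero)
      then show False using N(2) by (metis dvd_triv_left power_Suc)
    qed
  qed
  then have "infinite (range (\<lambda>k. 1 + N ^ Suc k))" by (rule range_inj_infinite)
  ultimately have "\<not> range (\<lambda>k. 1 + N ^ Suc k) \<subseteq> {s. poly (det W) s = 0}" using finite_subset by blast
  then obtain k where k: "poly (det W) (1 + N ^ Suc k) \<noteq> 0" by blast
  define s where "s = 1 + N ^ Suc k"
  define R where "R = det (Ws s)"
  define A where "A = adj_mat (Ws s)"
  have A: "A \<in> carrier_mat n n" "A * Ws s = R \<cdot>\<^sub>m 1\<^sub>m n"
    using adj_mat[OF Ws[of s]] by (auto simp: A_def R_def)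
  have 1: "1 < n" using n2 by simp
  define q where "q = (\<Sum>j<n. monom (A $$ (1, j)) j)"
  have "V s ^ j = (\<Sum>i<n. E (Ws s $$ (j, i)) * \<theta> ^ i)" if "j < n" for j
    unfolding w using that by (intro sum.cong) (auto simp: Ws_def W_def)
  then have "(\<Sum>j<n. E (A $$ (1, j)) * V s ^ j) = (\<Sum>i<n. E ((A * Ws s) $$ (1, i)) * \<theta> ^ i)"
    by (rule compose_coefficients[OF A(1) Ws 1])
  also have "\<dots> = (\<Sum>i<n. if i = 1 then E R * \<theta> else 0)"
    unfolding A(2) using 1 by (intro sum.cong) auto
  also have "\<dots> = E R * \<theta>" using 1 by simp
  also have "(\<Sum>j<n. E (A $$ (1, j)) * V s ^ j) = poly (map_poly E q) (V s)"
    by (simp add: q_def Ep.hom_sum poly_sum map_poly_monom poly_monom)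
  finally have "E R * \<theta> = poly (map_poly E q) (V s)" ..
  moreover have "N dvd s - 1" by (simp add: s_def)
  moreover have "R \<noteq> 0" using k by (simp add: R_def det s_def)
  ultimately show ?thesis unfolding V_def by blast
qed

definition pure :: "'l set \<Rightarrow> 'l \<Rightarrow> bool" where
  "pure J x \<longleftrightarrow> (\<forall>M g. M \<noteq> 0 \<longrightarrow> degree g < n - 1 \<longrightarrow> ev g * x \<in> mul M J \<longrightarrow> (\<exists>g'. g = smult M g'))"

lemma pureI:
  assumes J: "module_ideal J"
    and prime: "\<And>p g. irreducible p \<Longrightarrow> degree g < n - 1 \<Longrightarrow> ev g * x \<in> mul p J \<Longrightarrow> \<exists>g'. g = smult p g'"
  shows "pure J x"
proof -
  have "\<exists>g'. g = smult M g'" if "M \<noteq> 0" "degree g < n - 1" "ev g * x \<in> mul M J" for M g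
    using that
  proof (induction M arbitrary: g rule: factor_induct)
    case (unit a)
    then obtain b where "1 = a * b" by (elim dvdE)
    then have "g = smult a (smult b g)" by simp
    then show ?case by blast
  next
    case (factor p M)
    have "p \<noteq> 0" using factor(1) by auto
    have "ev g * x \<in> mul p J" using mul_closed(6)[OF J _ factor.prems(2), of p] by simp
    then obtain g' where g': "g = smult p g'" using prime factor by blast
    obtain j where "j \<in> J" "ev g * x = E (p * M) * j" using factor.prems(2) by (auto simp: mul_iff)
    then have "ev g' * x = E M * j" using \<open>p \<noteq> 0\<close> unfolding g' by (simp add: E.hom_mult)
    moreover have "degree g' < n - 1" using factor.prems(1) \<open>p \<noteq> 0\<close> unfolding g' by simp
    ultimately obtain g'' where "g' = smult M g''"
      using factor.IH \<open>j \<in> J\<close> mul_iff by blast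
    then have "g = smult (p * M) g''" unfolding g' by simp
    then show ?case by blast
  qed
  then show ?thesis unfolding pure_def by blast
qed

lemma good_divides:
  assumes "good J p x" "degree g < n" "ev g * x \<in> mul p J"
  shows "\<exists>g'. g = smult p g'"
proof -
  have "ev g \<in> mul p B" using assms ev_in unfolding good_def by blast
  then show ?thesis using ev_in_multiple[OF assms(2)] unfolding mul_iff by metis
qed

lemma linear_multiple_divides:
  assumes p: "p \<noteq> 0" and g: "degree g < n - 1" and e: "(\<theta> - E l) * ev g \<in> mul p B"
  shows "\<exists>g'. g = smult p g'"
proof -
  have "degree ([:- l, 1:] * g) \<le> degree [:- l, 1:] + degree g" by (rule degree_mult_le)
  then have deg: "degree ([:- l, 1:] * g) < n" using g n2 by simp
  have "ev ([:- l, 1:] * g) = (\<theta> - E l) * ev g" by (simp add: E.hom_uminus algebra_simps)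
  then obtain g' where g': "[:- l, 1:] * g = smult p g'"
    using e ev_in_multiple[OF deg] unfolding mul_iff by metis
  have "p * poly g' l = 0" using arg_cong[OF g', of "\<lambda>q. poly q l"] by simp
  then have "[:- l, 1:] dvd g'" using p by (simp add: poly_eq_0_iff_dvd)
  then obtain g'' where "g' = [:- l, 1:] * g''" by (elim dvdE)
  then have "[:- l, 1:] * g = [:- l, 1:] * smult p g''" using g' by simp
  then have "g = smult p g''" by (metis mult_left_cancel one_neq_zero pCons_eq_0_iff)
  then show ?thesis by blast
qed

lemma poly_eval_diff:
  assumes "x \<in> B"
  obtains y where "y \<in> B" "poly (map_poly E q) x - E (poly q l) = y * (x - E l)"
proof -
  have "poly (map_poly E q) x = poly (map_poly E ([:- l, 1:] * synthetic_div q l + [:poly q l:])) x"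
    by (simp only: synthetic_div_correct')
  also have "\<dots> = (x - E l) * poly (map_poly E (synthetic_div q l)) x + E (poly q l)"
    unfolding Ep.hom_add Ep.hom_mult poly_add poly_mult
    by (simp add: E.map_poly_pCons_hom E.hom_uminus)
  finally show thesis
    by (intro that[of "poly (map_poly E (synthetic_div q l)) x"] poly_eval_in assms) simp
qed

lemma pure_complement:
  assumes J: "module_ideal J" and x: "x \<in> J" "x \<noteq> 0" "pure J x"
  obtains w where "w \<in> J" "\<And>y. y \<in> J \<Longrightarrow> \<exists>g c. degree g < n - 1 \<and> y = x * ev g + E c * w"
proof -
  note D = module_idealD[OF J]
  obtain x' M where x': "x' \<in> B" "M \<noteq> 0" "x * x' = E M" using ex_norm[OF D(1)[OF x(1)] x(2)] .
  have rep: "\<exists>g. degree g < n \<and> E M * y = x * ev g" if y: "y \<in> J" for y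
  proof -
    obtain g where "degree g < n" "x' * y = ev g" using adjoin_repr adjoin_mult[OF x'(1) D(1)[OF y]] by blast
    then show ?thesis using x'(3) by (metis mult.assoc)
  qed
  define T where "T = {coeff g (n - 1) | g. degree g < n \<and> (\<exists>y\<in>J. E M * y = x * ev g)}"
  have "0 \<in> T" unfolding T_def using n2 D(2) by (auto intro!: exI[of _ 0])
  moreover have "a + b \<in> T" if ab: "a \<in> T" "b \<in> T" for a b
  proof -
    obtain g g' y y' where g: "a = coeff g (n - 1)" "degree g < n" "y \<in> J" "E M * y = x * ev g"
      "b = coeff g' (n - 1)" "degree g' < n" "y' \<in> J" "E M * y' = x * ev g'"
      using ab unfolding T_def by blast
    then have "a + b = coeff (g + g') (n - 1)" "degree (g + g') < n" "E M * (y + y') = x * ev (g + g')" "y + y' \<in> J"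
      using degree_add_less[of g n g'] D(3) by (auto simp: distrib_left)
    then show ?thesis unfolding T_def by blast
  qed
  moreover have "r * a \<in> T" if a: "a \<in> T" for r a
  proof -
    obtain g y where g: "a = coeff g (n - 1)" "degree g < n" "y \<in> J" "E M * y = x * ev g"
      using a unfolding T_def by blast
    then have "r * a = coeff (smult r g) (n - 1)" "degree (smult r g) < n" "E M * (E r * y) = x * ev (smult r g)" "E r * y \<in> J"
      using D(7) degree_smult_le[of r g] by (auto simp: mult.left_commute)
    then show ?thesis unfolding T_def by blast
  qed
  ultimately obtain \<tau> where \<tau>: "T = {c. \<tau> dvd c}" using ideal_principal by metis
  then have "\<tau> \<in> T" by simp
  then obtain gw w where w: "\<tau> = coeff gw (n - 1)" "degree gw < n" "w \<in> J" "E M * w = x * ev gw"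
    unfolding T_def by blast
  show thesis
  proof (rule that[OF w(3)])
    fix y assume y: "y \<in> J"
    then obtain g where g: "degree g < n" "E M * y = x * ev g" using rep by blast
    then have "coeff g (n - 1) \<in> T" unfolding T_def using y by blast
    then obtain c where c: "coeff g (n - 1) = \<tau> * c" unfolding \<tau> by (auto elim: dvdE)
    define d where "d = g - smult c gw"
    have "degree d \<le> n - 1" unfolding d_def using g(1) w(2) degree_smult_le[of c gw]
      by (intro degree_diff_le) auto
    moreover have "coeff d (n - 1) = 0" unfolding d_def using c w(1) by simp
    ultimately have deg: "degree d < n - 1"
      using n2 leading_coeff_0_iff[of d] by (cases "degree d = n - 1") auto
    have eq: "ev d * x = E M * (y - E c * w)"
      unfolding d_def using g(2) w(4) by (simp add: algebra_simps)
    moreover have yw: "y - E c * w \<in> J" by (intro D(5,7) y w)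
    ultimately obtain g' where g': "d = smult M g'" using x(3) x'(2) deg unfolding pure_def mul_iff by blast
    have "E M * (ev g' * x) = E M * (y - E c * w)" using eq unfolding g' by (simp add: mult.assoc)
    then have "ev g' * x = y - E c * w" using x'(2) by simp
    then have "y = x * ev g' + E c * w" by (simp add: algebra_simps)
    moreover have "degree g' < n - 1" using deg x'(2) unfolding g' by simp
    ultimately show "\<exists>g c. degree g < n - 1 \<and> y = x * ev g + E c * w" by blast
  qed
qed

lemma pure_C_vec:
  assumes J: "module_ideal J" and x: "x \<in> J" "x \<noteq> 0" "pure J x"
  obtains a z where "a \<noteq> 0" "a dvd poly f z"
    "(\<lambda>t. (\<theta> - E z) * t) ` J = (\<lambda>t. x * t) ` base_span h (C_vec a z)"
proof -
  note D = module_idealD[OF J]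
  obtain w where w: "w \<in> J" "\<And>y. y \<in> J \<Longrightarrow> \<exists>g c. degree g < n - 1 \<and> y = x * ev g + E c * w"
    using pure_complement[OF assms] by blast
  obtain g z where g: "degree g < n - 1" "\<theta> * w = x * ev g + E z * w"
    using w(2)[OF D(4)[OF adjoin_theta w(1)]] by blast
  define q a where "q = synthetic_div g z" and "a = poly g z"
  have "ev g = ev ([:- z, 1:] * q + [:a:])" unfolding q_def a_def by (simp only: synthetic_div_correct')
  then have evg: "ev g = (\<theta> - E z) * ev q + E a" by (simp add: E.hom_uminus algebra_simps)
  have degq: "degree q < n - 1" unfolding q_def using g(1) by (simp add: degree_synthetic_div)
  define w' where "w' = w - x * ev q"
  have xe: "x * ev r \<in> J" for r using D(4)[OF ev_in x(1)] by (simp add: mult.commute)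
  have w'J: "w' \<in> J" unfolding w'_def by (intro D(5) w xe)
  have w': "(\<theta> - E z) * w' = x * E a"
    unfolding w'_def using g(2) evg by (simp add: algebra_simps)
  have rep: "\<exists>g c. degree g < n - 1 \<and> y = x * ev g + E c * w'" if "y \<in> J" for y
  proof -
    obtain r c where r: "degree r < n - 1" "y = x * ev r + E c * w" using w(2)[OF \<open>y \<in> J\<close>] by blast
    then have "y = x * ev (r + smult c q) + E c * w'" unfolding w'_def by (simp add: algebra_simps)
    moreover have "degree (r + smult c q) < n - 1"
      using r degq degree_smult_le[of c q] by (intro degree_add_less) auto
    ultimately show ?thesis by blast
  qed
  have \<theta>z: "\<theta> - E z \<noteq> 0" using theta_not_base[of z] by simp
  have "a \<noteq> 0"
  proof
    assume "a = 0"
    then have "w' = 0" using w' \<theta>z by simp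
    then obtain r where r: "degree r < n - 1" "x * ev (monom 1 (n - 1)) = x * ev r"
      using rep[OF xe[of "monom 1 (n - 1)"]] by auto
    then have "ev (monom 1 (n - 1)) = ev r" using x(2) by simp
    then have "monom 1 (n - 1) = r" using r(1) n2 by (intro ev_inj) (auto simp: degree_monom_eq)
    then show False using r(1) by (auto simp: degree_monom_eq)
  qed
  let ?S = "base_span h (C_vec a z)"
  have "y \<in> (\<lambda>t. (\<theta> - E z) * t) ` J \<longleftrightarrow> y \<in> (\<lambda>t. x * t) ` ?S" for y
  proof
    assume "y \<in> (\<lambda>t. (\<theta> - E z) * t) ` J"
    then obtain t where t: "t \<in> J" "y = (\<theta> - E z) * t" by blast
    obtain r c where r: "degree r < n - 1" "t = x * ev r + E c * w'" using rep[OF t(1)] by blast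
    have "y = x * ((\<theta> - E z) * ev r) + E c * ((\<theta> - E z) * w')"
      unfolding t(2) r(2) by (simp add: algebra_simps)
    then have "y = x * ((\<theta> - E z) * ev r + E (a * c))"
      unfolding w' by (simp add: E.hom_mult algebra_simps)
    moreover have "(\<theta> - E z) * ev r + E (a * c) \<in> ?S" unfolding C_vec_span_iff using r(1) by blast
    ultimately show "y \<in> (\<lambda>t. x * t) ` ?S" by blast
  next
    assume "y \<in> (\<lambda>t. x * t) ` ?S"
    then obtain u where u: "u \<in> ?S" "y = x * u" by blast
    then obtain r c where "u = (\<theta> - E z) * ev r + E (a * c)" unfolding C_vec_span_iff by blast
    then have "y = x * ((\<theta> - E z) * ev r + E (a * c))" using u(2) by simp
    then have "y = (\<theta> - E z) * (x * ev r) + E c * (x * E a)" by (simp add: E.hom_mult algebra_simps)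
    then have "y = (\<theta> - E z) * (x * ev r + E c * w')" unfolding w'[symmetric] by (simp add: algebra_simps)
    moreover have "x * ev r + E c * w' \<in> J" by (intro D(3,7) xe w'J)
    ultimately show "y \<in> (\<lambda>t. (\<theta> - E z) * t) ` J" by blast
  qed
  then have eq: "(\<lambda>t. (\<theta> - E z) * t) ` J = (\<lambda>t. x * t) ` ?S" by (rule Set.set_eqI)
  have mult_closed: "b * y \<in> ?S" if b: "b \<in> B" and y: "y \<in> ?S" for b y
  proof -
    have "x * y \<in> (\<lambda>t. (\<theta> - E z) * t) ` J" unfolding eq using y by blast
    then obtain t where t: "t \<in> J" "x * y = (\<theta> - E z) * t" by blast
    have "x * (b * y) = (\<theta> - E z) * (b * t)" using t(2) by (simp add: mult.left_commute)
    then have "x * (b * y) \<in> (\<lambda>t. x * t) ` ?S" unfolding eq[symmetric] using D(4)[OF b t(1)] by blast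
    then show ?thesis using x(2) by auto
  qed
  have "a dvd poly f z"
  proof -
    have "\<theta> - E z \<in> ?S" unfolding C_vec_span_iff
      by (rule exI[of _ 1], rule exI[of _ 0]) (use n2 in simp)
    from mult_closed[OF ev_in this, of "- synthetic_div f z"]
    have "E (poly f z) \<in> ?S" using theta_minus_dvd_f[of z] by (simp add: mult.commute)
    then obtain r c where r: "degree r < n - 1" "E (poly f z) = (\<theta> - E z) * ev r + E (a * c)"
      unfolding C_vec_span_iff by blast
    have "degree ([:- z, 1:] * r) \<le> degree [:- z, 1:] + degree r" by (rule degree_mult_le)
    then have deg: "degree ([:- z, 1:] * r) < n" using r(1) by simp
    have "ev [:poly f z:] = ev ([:- z, 1:] * r + [:a * c:])"
      using r(2) by (simp add: E.hom_uminus algebra_simps)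
    moreover have "degree ([:- z, 1:] * r + [:a * c:]) < n" using deg n2 by (intro degree_add_less) simp_all
    ultimately have "[:poly f z:] = [:- z, 1:] * r + [:a * c:]" using n2 by (intro ev_inj) simp_all
    from arg_cong[OF this, of "\<lambda>q. poly q z"] show ?thesis by simp
  qed
  then show thesis using that \<open>a \<noteq> 0\<close> eq by blast
qed

end

section \<open>Integrally closed monogenic extensions\<close>

locale integrally_closed_monogenic = monogenic +
  assumes closed: "adjoin h \<theta> = integral_closure h"
begin

lemma integral_root:
  assumes "lead_coeff q = 1" "poly (map_poly E q) x = 0"
  shows "x \<in> B"
  unfolding closed integral_closure_def using assms by blast

lemma multiplier_divisible:
  assumes J: "module_ideal (base_span h v)" and v: "dim_vec v = n" and c: "c \<noteq> 0" and b: "b \<in> B"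
    and mult: "\<And>i. i < n \<Longrightarrow> b * v $ i \<in> mul c (base_span h v)"
  shows "b \<in> mul c B"
proof -
  define x where "x = b / E c"
  have bx: "b = E c * x" unfolding x_def using c by simp
  have "\<exists>d. x * v $ i = (\<Sum>j<n. E (d j) * v $ j)" if i: "i < n" for i
  proof -
    obtain t where "t \<in> base_span h v" "b * v $ i = E c * t" using mult[OF i] unfolding mul_iff by blast
    then have "x * v $ i \<in> base_span h v" unfolding bx using c by (simp add: mult.assoc)
    then show ?thesis unfolding base_span_iff[OF v] .
  qed
  then obtain m where m: "\<And>i. i < n \<Longrightarrow> x * v $ i = (\<Sum>j<n. E (m i j) * v $ j)" by metis
  define M where "M = mat n n (\<lambda>(i, j). m i j)"
  have M: "M \<in> carrier_mat n n" by (simp add: M_def)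
  have "map_mat E M *\<^sub>v v = x \<cdot>\<^sub>v v"
    by (rule eq_vecI) (use v m in \<open>auto simp: M_def scalar_prod_def lessThan_atLeast0\<close>)
  moreover have "v \<noteq> 0\<^sub>v n"
  proof
    assume "v = 0\<^sub>v n"
    then have "base_span h v = {0}" unfolding base_span_def by auto
    then show False using J unfolding module_ideal_def by blast
  qed
  moreover have "v \<in> carrier_vec n" using v by (rule carrier_vecI)
  moreover have "dim_row (map_mat E M) = n" using M by simp
  ultimately have "eigenvector (map_mat E M) v x" unfolding eigenvector_def by simp
  then have "eigenvalue (map_mat E M) x" unfolding eigenvalue_def by blast
  then have "poly (map_poly E (char_poly M)) x = 0"
    using eigenvalue_root_char_poly[of "map_mat E M" n x] E.char_poly_hom[OF M] M by simp
  then have "x \<in> B" using degree_monic_char_poly[OF M] by (intro integral_root[of "char_poly M"]) auto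
  then show ?thesis using bx mul_iff by blast
qed

text \<open>
  A monic equation for \<open>a\<close> is read modulo \<open>p\<close>, starting from its lowest coefficient prime to \<open>p\<close>.
\<close>

lemma stationary_power:
  assumes p: "irreducible p" and a: "a \<in> B"
  shows "\<exists>k. \<exists>b\<in>B. a ^ k * (1 - a * b) \<in> mul p B"
proof -
  have *: "\<exists>k. \<exists>b\<in>B. a ^ k * (1 - a * b) \<in> mul p B"
    if "\<exists>i. \<not> p dvd coeff q i" "a ^ m * poly (map_poly E q) a \<in> mul p B" for q m
    using that
  proof (induction q arbitrary: m)
    case (pCons c q)
    define y where "y = poly (map_poly E q) a"
    have yB: "y \<in> B" unfolding y_def by (rule poly_eval_in[OF a])
    have eq: "a ^ m * (E c + a * y) \<in> mul p B"
      using pCons.prems(2) by (simp add: E.map_poly_pCons_hom y_def)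
    show ?case
    proof (cases "p dvd c")
      case True
      have "\<exists>i. \<not> p dvd coeff q i"
        using pCons.prems(1) True by (metis coeff_pCons_0 coeff_pCons_Suc not0_implies_Suc)
      moreover have "a ^ Suc m * y \<in> mul p B"
      proof -
        have "a ^ Suc m * y = a ^ m * (E c + a * y) - a ^ m * (E c * 1)" by (simp add: algebra_simps)
        also have "\<dots> \<in> mul p B"
          by (intro mulB_closed(2) eq mulB_closed(3) mulB_closed(6)[OF True] mulB_closed(4) adjoin_closed a)
        finally show ?thesis .
      qed
      ultimately show ?thesis using pCons.IH y_def by blast
    next
      case False
      then obtain u w where uw: "u * c + w * p = 1" using irreducible_coprime[OF p] by blast
      have "a ^ m * (1 - a * (- E u * y)) = a ^ m * (E (u * c + w * p) + a * (E u * y))"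
        unfolding uw by simp
      also have "\<dots> = E u * (a ^ m * (E c + a * y)) + E p * (E w * a ^ m)"
        by (simp add: E.hom_add E.hom_mult algebra_simps)
      also have "\<dots> \<in> mul p B" by (intro mulB_closed(1,3,4) eq adjoin_closed a)
      finally show ?thesis using yB adjoin_closed by metis
    qed
  qed simp
  obtain q where q: "lead_coeff q = 1" "poly (map_poly E q) a = 0"
    using a unfolding closed integral_closure_def by blast
  have "\<not> p dvd coeff q (degree q)" using q(1) p by (simp add: irreducible_def)
  then show ?thesis using *[of q 0] q(2) mulB_closed(4)[OF adjoin_0, of p] by auto
qed

lemma idempotent_mod:
  assumes p: "irreducible p" and a: "a \<in> B"
  obtains \<epsilon> k c where "c \<in> B" "\<epsilon> = a * c" "\<epsilon> * \<epsilon> - \<epsilon> \<in> mul p B" "(1 - \<epsilon>) * a ^ k \<in> mul p B"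
proof -
  obtain k0 b where b: "b \<in> B" and k0: "a ^ k0 * (1 - a * b) \<in> mul p B" using stationary_power[OF assms] by blast
  define k where "k = Suc k0"
  have k: "a ^ k * (1 - a * b) \<in> mul p B"
    using mulB_closed(3)[OF a k0] by (simp add: k_def mult.assoc)
  have j: "a ^ k * (1 - (a * b) ^ j) \<in> mul p B" for j
  proof (induction j)
    case (Suc j)
    have "a ^ k * (1 - (a * b) ^ Suc j) = a ^ k * (1 - (a * b) ^ j) + (a * b) ^ j * (a ^ k * (1 - a * b))"
      by (simp add: algebra_simps)
    also have "\<dots> \<in> mul p B" by (intro mulB_closed(1,3) Suc k adjoin_closed a b)
    finally show ?case .
  qed (use mulB_closed(4)[OF adjoin_0] in simp)
  define \<epsilon> where "\<epsilon> = (a * b) ^ k"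
  show thesis
  proof (rule that)
    show "b * (a * b) ^ k0 \<in> B" by (intro adjoin_closed a b)
    show "\<epsilon> = a * (b * (a * b) ^ k0)" by (simp add: \<epsilon>_def k_def)
    have "\<epsilon> * \<epsilon> - \<epsilon> = - (b ^ k) * (a ^ k * (1 - (a * b) ^ k))"
      unfolding \<epsilon>_def by (simp add: power_mult_distrib algebra_simps)
    also have "\<dots> \<in> mul p B" by (intro mulB_closed(3) j adjoin_closed b)
    finally show "\<epsilon> * \<epsilon> - \<epsilon> \<in> mul p B" .
    show "(1 - \<epsilon>) * a ^ k \<in> mul p B" using j[of k] by (simp add: \<epsilon>_def mult.commute)
  qed
qed

text \<open>
  Modulo \<open>p\<close>, \<open>z\<close> is \<open>y\<close> on the idempotent part where \<open>s\<close> is invertible, and \<open>x\<close> where \<open>s\<close> is nilpotent.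
\<close>

lemma common_annihilator:
  assumes J: "module_ideal J" and p: "irreducible p" and x: "x \<in> J" and y: "y \<in> J"
  obtains z where "z \<in> J" "\<And>e. e \<in> B \<Longrightarrow> e * z \<in> mul p J \<Longrightarrow> e * x \<in> mul p J \<and> e * y \<in> mul p J"
proof -
  note D = module_idealD[OF J] and M = mul_closed[OF J]
  define I where "I x = {g. ev g * x \<in> mul p J}" for x
  have I: "[:p:] \<in> I x" "g \<in> I x \<Longrightarrow> g' \<in> I x \<Longrightarrow> g + g' \<in> I x" "g \<in> I x \<Longrightarrow> r * g \<in> I x"
    if "x \<in> J" for x g g' r
    using that M(4) M(1) M(3)[OF ev_in] by (auto simp: I_def distrib_right mult.assoc)
  have "\<exists>s. (\<forall>e\<in>I y. s * e \<in> I x) \<and> (\<forall>e\<in>I x. (1 - s) * e \<in> I y)"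
  proof (rule complementary_multipliers[OF p I[OF x] I[OF y]])
    fix s assume "\<And>e. e \<in> I y \<Longrightarrow> s * e \<in> I x" "\<And>e. e \<in> I x \<Longrightarrow> (1 - s) * e \<in> I y"
    then show ?thesis by (intro exI[of _ s] conjI ballI)
  qed
  then obtain s where s: "\<And>e. e \<in> I y \<Longrightarrow> s * e \<in> I x" "\<And>e. e \<in> I x \<Longrightarrow> (1 - s) * e \<in> I y"
    by blast
  define S where "S = ev s"
  have S: "S \<in> B" unfolding S_def by (rule ev_in)
  have sx: "S * e * x \<in> mul p J" if "e \<in> B" "e * y \<in> mul p J" for e
    using that s(1) unfolding adjoin_iff I_def S_def by auto
  have sy: "(1 - S) * e * y \<in> mul p J" if "e \<in> B" "e * x \<in> mul p J" for e
    using that s(2) unfolding adjoin_iff I_def S_def by auto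
  obtain \<epsilon> k c where \<epsilon>: "c \<in> B" "\<epsilon> = S * c" "\<epsilon> * \<epsilon> - \<epsilon> \<in> mul p B" "(1 - \<epsilon>) * S ^ k \<in> mul p B"
    using idempotent_mod[OF p S] by blast
  have \<epsilon>B: "\<epsilon> \<in> B" unfolding \<epsilon>(2) by (intro adjoin_closed S \<epsilon>)
  define z where "z = \<epsilon> * y + (1 - \<epsilon>) * x"
  show thesis
  proof (rule that)
    show "z \<in> J" unfolding z_def by (intro D(3,4) x y adjoin_closed \<epsilon>B)
    fix e assume e: "e \<in> B" and ez: "e * z \<in> mul p J"
    have ey: "(\<epsilon> * e) * y \<in> mul p J"
    proof -
      have "(\<epsilon> * e) * y = \<epsilon> * (e * z) - (\<epsilon> * \<epsilon> - \<epsilon>) * (e * (y - x))"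
        by (simp add: z_def algebra_simps)
      also have "\<dots> \<in> mul p J" by (intro M(2) M(3)[OF \<epsilon>B ez] M(5)[OF \<epsilon>(3)] D(4,5) e x y)
      finally show ?thesis .
    qed
    have ex: "((1 - \<epsilon>) * e) * x \<in> mul p J"
    proof -
      have "((1 - \<epsilon>) * e) * x = e * z - (\<epsilon> * e) * y" by (simp add: z_def algebra_simps)
      then show ?thesis using M(2)[OF ez ey] by simp
    qed
    have "e * x \<in> mul p J"
    proof -
      have "e * x = c * (S * (\<epsilon> * e) * x) - (\<epsilon> * \<epsilon> - \<epsilon>) * (e * x) + ((1 - \<epsilon>) * e) * x"
        unfolding \<epsilon>(2) by (simp add: algebra_simps)
      also have "\<dots> \<in> mul p J"
        by (intro M(1,2) M(3)[OF \<epsilon>(1)] sx ey ex M(5)[OF \<epsilon>(3)] D(4) x e adjoin_closed \<epsilon>B)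
      finally show ?thesis .
    qed
    moreover have "e * y \<in> mul p J"
    proof -
      define g where "g = (\<Sum>i<k. S ^ i)"
      have g: "g \<in> B" "(1 - S) * g = 1 - S ^ k"
        unfolding g_def by (auto intro!: adjoin_sum adjoin_power S simp: one_diff_power_eq)
      have "e * y = (1 - S ^ k + S ^ k) * (1 - \<epsilon>) * e * y + \<epsilon> * e * y"
        by (simp add: algebra_simps)
      also have "\<dots> = g * ((1 - S) * ((1 - \<epsilon>) * e) * y) + ((1 - \<epsilon>) * S ^ k) * (e * y) + \<epsilon> * e * y"
        unfolding g(2)[symmetric] by (simp add: algebra_simps)
      also have "\<dots> \<in> mul p J"
        by (intro M(1) M(3)[OF g(1)] sy ey ex M(5)[OF \<epsilon>(4)] D(4) y e adjoin_closed \<epsilon>B)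
      finally show ?thesis .
    qed
    ultimately show "e * x \<in> mul p J \<and> e * y \<in> mul p J" ..
  qed
qed

lemma ex_good:
  assumes J: "module_ideal (base_span h v)" and v: "dim_vec v = n" and p: "irreducible p"
  obtains x where "x \<in> base_span h v" "good (base_span h v) p x"
proof -
  let ?J = "base_span h v"
  have "\<exists>z\<in>?J. \<forall>e\<in>B. e * z \<in> mul p ?J \<longrightarrow> (\<forall>i<m. e * v $ i \<in> mul p ?J)" if "m \<le> n" for m
    using that
  proof (induction m)
    case 0
    then show ?case using module_idealD(2)[OF J] by auto
  next
    case (Suc m)
    then obtain z where z: "z \<in> ?J" "\<And>e i. e \<in> B \<Longrightarrow> e * z \<in> mul p ?J \<Longrightarrow> i < m \<Longrightarrow> e * v $ i \<in> mul p ?J"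
      by auto
    have vm: "v $ m \<in> ?J" using base_span_closed(4)[OF v] Suc.prems by simp
    obtain z' where z': "z' \<in> ?J"
      "\<And>e. e \<in> B \<Longrightarrow> e * z' \<in> mul p ?J \<Longrightarrow> e * z \<in> mul p ?J \<and> e * v $ m \<in> mul p ?J"
      using common_annihilator[OF J p z(1) vm] by blast
    have "\<forall>e\<in>B. e * z' \<in> mul p ?J \<longrightarrow> (\<forall>i<Suc m. e * v $ i \<in> mul p ?J)"
      using z z' less_Suc_eq by metis
    then show ?case using z'(1) by blast
  qed
  from this[of n] obtain z where z: "z \<in> ?J"
    "\<And>e i. e \<in> B \<Longrightarrow> e * z \<in> mul p ?J \<Longrightarrow> i < n \<Longrightarrow> e * v $ i \<in> mul p ?J" by auto
  have "p \<noteq> 0" using p by auto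
  then have "good ?J p z" unfolding good_def using multiplier_divisible[OF J v] z(2) by blast
  then show thesis using that z(1) by blast
qed

lemma ex_good_all:
  assumes J: "module_ideal (base_span h v)" and v: "dim_vec v = n" and N: "N \<noteq> 0"
  shows "\<exists>x\<in>base_span h v. \<forall>p. irreducible p \<longrightarrow> p dvd N \<longrightarrow> good (base_span h v) p x"
  using N
proof (induction N rule: factor_induct)
  case (unit a)
  have "\<not> p dvd a" if "irreducible p" for p using that unit by (metis dvd_trans irreducible_def)
  then show ?case using module_idealD(2)[OF J] by blast
next
  let ?J = "base_span h v"
  note D = module_idealD[OF J] and M = mul_closed[OF J]
  case (factor q R)
  then obtain x where x: "x \<in> ?J" "\<And>p. irreducible p \<Longrightarrow> p dvd R \<Longrightarrow> good ?J p x" by blast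
  show ?case
  proof (cases "q dvd R")
    case True
    then have "p dvd R" if "irreducible p" "p dvd q * R" for p
      using irreducible_prime[OF that] dvd_trans by blast
    then show ?thesis using x by blast
  next
    case False
    then obtain u w where uw: "u * R + w * q = 1" using irreducible_coprime[OF factor(1)] by blast
    obtain y where y: "y \<in> ?J" "good ?J q y" using ex_good[OF J v factor(1)] .
    define z where "z = E (u * R) * y + E (w * q) * x"
    have zJ: "z \<in> ?J" unfolding z_def by (intro D(3,7) x y)
    have Ew: "E (w * q) = 1 - E (u * R)" using arg_cong[OF uw, of E] by (simp add: E.hom_add eq_diff_eq add.commute)
    have "z - x = E R * (E u * (y - x))" unfolding z_def Ew by (simp add: E.hom_mult algebra_simps)
    then have zx: "z - x \<in> mul R ?J" using M(4) D(5,7) x y by metis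
    have "z - y = E (w * q) * (x - y)" unfolding z_def Ew by (simp add: algebra_simps)
    also have "\<dots> = E q * (E w * (x - y))" by (simp add: E.hom_mult algebra_simps)
    finally have "z - y \<in> mul q ?J" using M(4) D(5,7) x y by metis
    then have good_q: "good ?J q z" by (rule good_cong[OF J y(2)])
    have "good ?J p z" if p: "irreducible p" "p dvd q * R" for p
    proof (cases "p dvd R")
      case True
      show ?thesis using good_cong[OF J x(2)[OF p(1) True]] M(6)[OF True zx] by blast
    next
      case False
      then have pq: "p dvd q" using irreducible_prime[OF p] by blast
      then have qp: "q dvd p" using irreducible_dvd_sym p(1) factor(1) by blast
      show ?thesis using good_q unfolding good_def using M(6)[OF qp] mulB_closed(6)[OF pq] by blast
    qed
    then show ?thesis using zJ by blast
  qed
qed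

lemma ex_pure:
  assumes J: "module_ideal (base_span h v)" and v: "dim_vec v = n"
  obtains x where "x \<in> base_span h v" "x \<noteq> 0" "pure (base_span h v) x"
proof -
  let ?J = "base_span h v"
  note D = module_idealD[OF J] and M = mul_closed[OF J]
  obtain N where N: "N \<noteq> 0" "E N \<in> ?J" using module_ideal_contains_base[OF J] .
  show thesis
  proof (cases "N dvd 1")
    case True
    have "pure ?J (E N)"
    proof (rule pureI[OF J])
      fix p g assume p: "irreducible p" and g: "degree g < n - 1" "ev g * E N \<in> mul p ?J"
      have "\<not> p dvd N" using p True by (metis dvd_trans irreducible_def)
      from good_divides[OF good_base[OF J p this] _ g(2)] show "\<exists>g'. g = smult p g'" using g(1) by simp
    qed
    then show ?thesis using that N by simp
  next
    case False
    obtain v0 where v0: "v0 \<in> ?J" "\<And>p. irreducible p \<Longrightarrow> p dvd N \<Longrightarrow> good ?J p v0"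
      using ex_good_all[OF J v N(1)] by blast
    obtain s R q where s: "N dvd s - 1" and R: "R \<noteq> 0"
      and q: "E R * \<theta> = poly (map_poly E q) (E s * v0 + E (N ^ 2) * \<theta>)"
      using generic_element[OF D(1)[OF v0(1)] N(1) False] by blast
    define w where "w = E s * v0 + E (N ^ 2) * \<theta>"
    have N2: "E (N ^ 2) * \<theta> = E N * (\<theta> * E N)" by (simp add: E.hom_mult power2_eq_square)
    have wJ: "w \<in> ?J" unfolding w_def N2 by (intro D(3) D(7)[OF v0(1)] D(7) D(4) adjoin_theta N)
    obtain t where t: "N dvd t - 1" "\<And>p. irreducible p \<Longrightarrow> p dvd R \<Longrightarrow> \<not> p dvd N \<Longrightarrow> p dvd t"
      using congruent_one_divisible[OF R, of N] by blast
    define x where "x = E N + E t * (w - E N)"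
    have xJ: "x \<in> ?J" unfolding x_def by (intro D(3,5,7) N wJ)
    have good_dvd: "good ?J p x" if p: "irreducible p" "p dvd N" for p
    proof (rule good_cong[OF J v0(2)[OF p]])
      obtain s' t' where st: "s - 1 = N * s'" "t - 1 = N * t'" using s t(1) by (elim dvdE)
      have s1: "E s - 1 = E N * E s'" and t1: "E t - 1 = E N * E t'"
        using arg_cong[OF st(1), of E] arg_cong[OF st(2), of E] by (simp_all add: E.hom_minus E.hom_mult)
      have "x - v0 = (E t - 1) * (w - E N) + ((E s - 1) * v0 + E N * (\<theta> * E N))"
        unfolding x_def w_def N2 by (simp add: algebra_simps)
      also have "\<dots> = E N * (E t' * (w - E N)) + (E N * (E s' * v0) + E N * (\<theta> * E N))"
        unfolding s1 t1 by (simp add: mult.assoc)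
      also have "\<dots> \<in> mul N ?J"
        by (intro M(1) M(4) D(7) D(5) D(4) wJ v0 N adjoin_theta)
      finally show "x - v0 \<in> mul p ?J" by (rule M(6)[OF p(2)])
    qed
    have "pure ?J x"
    proof (rule pureI[OF J])
      fix p g assume p: "irreducible p" and g: "degree g < n - 1" "ev g * x \<in> mul p ?J"
      have gn: "degree g < n" using g(1) by simp
      consider "p dvd N" | "\<not> p dvd N" "p dvd t" | "\<not> p dvd N" "\<not> p dvd t" by blast
      then show "\<exists>g'. g = smult p g'"
      proof cases
        case 1
        show ?thesis by (rule good_divides[OF good_dvd[OF p 1] gn g(2)])
      next
        case 2
        have "x - E N = E t * (w - E N)" by (simp add: x_def)
        also have "\<dots> \<in> mul t ?J" by (intro M(4) D(5) wJ N)
        finally have "x - E N \<in> mul p ?J" by (rule M(6)[OF 2(2)])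
        then show ?thesis using good_divides[OF good_cong[OF J good_base[OF J p 2(1)]] gn g(2)] by blast
      next
        case 3
        then have "\<not> p dvd R" using t(2)[OF p] by blast
        obtain u u' where u: "u * t + u' * p = 1" using irreducible_coprime[OF p 3(2)] .
        define \<mu> where "\<mu> = u * N * (t - 1)"
        have w\<mu>: "(w - E \<mu>) * ev g \<in> mul p B"
        proof -
          have u1: "E u' * E p = 1 - E u * E t"
            using arg_cong[OF u, of E] by (simp add: E.hom_add E.hom_mult eq_diff_eq add.commute)
          have "(w - E \<mu>) * ev g = E u * (ev g * x) + (E u' * E p) * (w * ev g)"
            unfolding u1 \<mu>_def x_def by (simp add: E.hom_mult E.hom_minus algebra_simps)
          also have "(E u' * E p) * (w * ev g) = E p * (E u' * (w * ev g))" by (simp add: mult_ac)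
          also have "E u * (ev g * x) + \<dots> \<in> mul p B"
            by (intro mulB_closed(1) mulB_closed(3) mulB_closed(4) M(7) g(2) adjoin_closed ev_in D(1) wJ)
          finally show ?thesis .
        qed
        obtain y where y: "y \<in> B" "poly (map_poly E q) w - E (poly q \<mu>) = y * (w - E \<mu>)"
          using poly_eval_diff[OF D(1)[OF wJ]] .
        have R\<theta>: "(E R * \<theta> - E (poly q \<mu>)) * ev g \<in> mul p B"
          unfolding q[folded w_def] y(2) mult.assoc by (rule mulB_closed(3)[OF y(1) w\<mu>])
        obtain r r' where r: "r * R + r' * p = 1" using irreducible_coprime[OF p \<open>\<not> p dvd R\<close>] .
        have r1: "E r' * E p = 1 - E r * E R"
          using arg_cong[OF r, of E] by (simp add: E.hom_add E.hom_mult eq_diff_eq add.commute)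
        have "(\<theta> - E (r * poly q \<mu>)) * ev g
          = E r * ((E R * \<theta> - E (poly q \<mu>)) * ev g) + (E r' * E p) * (\<theta> * ev g)"
          unfolding r1 by (simp add: E.hom_mult algebra_simps)
        also have "(E r' * E p) * (\<theta> * ev g) = E p * (E r' * (\<theta> * ev g))" by (simp add: mult_ac)
        also have "E r * ((E R * \<theta> - E (poly q \<mu>)) * ev g) + \<dots> \<in> mul p B"
          by (intro mulB_closed(1) mulB_closed(3)[OF adjoin_E R\<theta>] mulB_closed(4) adjoin_closed ev_in)
        finally show ?thesis using linear_multiple_divides[OF _ g(1)] p by (metis not_irreducible_zero)
      qed
    qed
    moreover have "x \<noteq> 0"
    proof
      assume "x = 0"
      then have "ev 1 * x \<in> mul N ?J" using M(4)[OF D(2), of N] by simp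
      moreover have "degree (1 :: 'a poly) < n - 1" using n2 by simp
      ultimately obtain g' where "1 = smult N g'" using \<open>pure ?J x\<close> N(1) unfolding pure_def by blast
      from arg_cong[OF this, of "\<lambda>g. coeff g 0"] have "1 = N * coeff g' 0" by simp
      then show False using False by (metis dvd_triv_left)
    qed
    ultimately show ?thesis using that xJ by blast
  qed
qed

theorem similarity_class_C_mat:
  assumes "S \<in> similarity_classes n f"
  shows "\<exists>a z. a dvd poly f z \<and> C_mat n f a z \<in> S"
proof -
  obtain \<alpha> where \<alpha>: "\<alpha> \<in> carrier_mat n n" "char_poly \<alpha> = f" "S = similarity_class n \<alpha>"
    using assms unfolding similarity_classes_def by blast
  obtain v where v: "theta_eigenvector \<alpha> v" using ex_theta_eigenvector[OF \<alpha>(1,2)] .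
  note J = span_module_ideal[OF \<alpha>(1) v] and dim = theta_eigenvectorD(1)[OF \<alpha>(1) v]
  obtain x where x: "x \<in> base_span h v" "x \<noteq> 0" "pure (base_span h v) x"
    using ex_pure[OF J dim] .
  obtain a z where az: "a \<noteq> 0" "a dvd poly f z"
    "(\<lambda>t. (\<theta> - E z) * t) ` base_span h v = (\<lambda>t. x * t) ` base_span h (C_vec a z)"
    using pure_C_vec[OF J x] .
  have C: "theta_eigenvector (C_mat n f a z) (C_vec a z)" using C_mat_eigenvector az(1,2) by blast
  have "\<theta> - E z \<in> B" "\<theta> - E z \<noteq> 0" using theta_not_base[of z] by (auto intro: adjoin_closed)
  note ev1 = eigenvector_smult[OF \<alpha>(1) v this]
  note ev2 = eigenvector_smult[OF C_mat_carrier C module_idealD(1)[OF J x(1)] x(2)]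
  have "base_span h ((\<theta> - E z) \<cdot>\<^sub>v v) = base_span h (x \<cdot>\<^sub>v C_vec a z)"
    using base_span_smult[OF dim] base_span_smult[OF theta_eigenvectorD(1)[OF C_mat_carrier C]] az(3) by metis
  from same_span_similar[OF \<alpha>(1) ev1 C_mat_carrier ev2 this]
  have "C_mat n f a z \<in> S" unfolding \<alpha>(3) similarity_class_def using C_mat_carrier by simp
  then show ?thesis using az(2) by blast
qed

end

section \<open>Representation by fractions\<close>

lemma base_emb_hom:
  assumes "field_hom h"
  shows "inj_idom_hom (base_emb h)"
proof -
  interpret field_hom h by fact
  show ?thesis
    by unfold_locales (auto simp: base_emb_def hom_add hom_mult)
qed

lemma map_poly_base_emb: "field_hom h \<Longrightarrow> map_poly h (map_poly to_fract p) = map_poly (base_emb h) p"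
proof -
  assume "field_hom h"
  then interpret field_hom h .
  show ?thesis by (subst map_poly_map_poly) (auto simp: o_def base_emb_def[abs_def])
qed

lemma clear_denominators:
  fixes p :: "'a::idom fract poly"
  shows "\<exists>D P. D \<noteq> 0 \<and> smult (to_fract D) p = map_poly to_fract P"
proof (induction p)
  case 0
  show ?case by (intro exI[of _ 1] exI[of _ 0]) simp
next
  case (pCons c p)
  then obtain D P where DP: "D \<noteq> 0" "smult (to_fract D) p = map_poly to_fract P" by blast
  obtain a b where ab: "c = Fract a b" "b \<noteq> 0" by (cases c)
  have "smult (to_fract (b * D)) (pCons c p) = map_poly to_fract (pCons (a * D) (smult b P))"
  proof -
    have "to_fract b * c = to_fract a" using ab by (simp add: Fract_conv_to_fract)
    then have "to_fract (b * D) * c = to_fract (a * D)" by (simp add: mult.commute mult.left_commute)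
    moreover have "smult (to_fract (b * D)) p = map_poly to_fract (smult b P)"
    proof -
      have "smult (to_fract (b * D)) p = smult (to_fract b) (map_poly to_fract P)" by (simp flip: DP(2))
      then show ?thesis by (simp add: poly_eq_iff coeff_map_poly)
    qed
    ultimately show ?thesis
      by (simp del: to_fract_mult add: poly_eq_iff coeff_map_poly coeff_pCons split: nat.split) simp
  qed
  then show ?case using DP(1) ab(2) by (intro exI[of _ "b * D"] exI) auto
qed

lemma ex_base_multiple:
  assumes h: "field_hom h" and sep: "separable_extension h" and x: "x \<noteq> 0"
  shows "\<exists>C P. C \<noteq> 0 \<and> base_emb h C = x * poly (map_poly (base_emb h) P) x"
proof -
  interpret h: field_hom h by fact
  interpret E: inj_idom_hom "base_emb h" by (rule base_emb_hom[OF h])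
  interpret Ep: map_poly_inj_idom_hom "base_emb h" ..
  obtain p where p: "minimal_polynomial h p x" using sep unfolding separable_extension_def by blast
  obtain c p' where cp: "p = pCons c p'" by (cases p)
  have "p \<noteq> 0" using p unfolding minimal_polynomial_def by auto
  have root: "h c + x * poly (map_poly h p') x = 0"
    using p unfolding minimal_polynomial_def cp by (simp add: h.map_poly_pCons_hom)
  have "c \<noteq> 0"
  proof
    assume c: "c = 0"
    then have "p' \<noteq> 0" using \<open>p \<noteq> 0\<close> cp by auto
    moreover have "poly (map_poly h p') x = 0" using root c x by simp
    ultimately have "degree p \<le> degree p'" using p unfolding minimal_polynomial_def by blast
    then show False using \<open>p' \<noteq> 0\<close> cp by simp
  qed
  obtain D P where DP: "D \<noteq> 0" "smult (to_fract D) p = map_poly to_fract P" using clear_denominators by blast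
  obtain C P' where P: "P = pCons C P'" by (cases P)
  have "to_fract D * c = to_fract C" using arg_cong[OF DP(2), of "\<lambda>q. coeff q 0"] by (simp add: cp P coeff_map_poly)
  then have "C \<noteq> 0" using \<open>c \<noteq> 0\<close> DP(1) by auto
  have "poly (map_poly (base_emb h) P) x = poly (map_poly h (smult (to_fract D) p)) x"
    unfolding DP(2) map_poly_base_emb[OF h] ..
  also have "\<dots> = 0" using p unfolding minimal_polynomial_def by (simp add: h.map_poly_hom_smult)
  finally have "base_emb h C + x * poly (map_poly (base_emb h) P') x = 0" unfolding P by (simp add: E.map_poly_pCons_hom)
  then have "base_emb h C = x * poly (map_poly (base_emb h) (- P')) x"
    by (simp add: Ep.hom_uminus eq_neg_iff_add_eq_0)
  then show ?thesis using \<open>C \<noteq> 0\<close> by blast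
qed

lemma fraction_representation:
  fixes h :: "'a::idom fract \<Rightarrow> 'l::field"
  assumes h: "field_hom h" and sep: "separable_extension h"
    and gen: "generate_field (class_ring :: 'l ring) (insert \<theta> (range h)) = UNIV"
  shows "\<exists>N g. N \<noteq> 0 \<and> base_emb h N * y = poly (map_poly (base_emb h) g) \<theta>"
proof -
  interpret h: field_hom h by fact
  interpret E: inj_idom_hom "base_emb h" by (rule base_emb_hom[OF h])
  interpret Ep: map_poly_inj_idom_hom "base_emb h" ..
  define ev where "ev g = poly (map_poly (base_emb h) g) \<theta>" for g
  have ev: "ev (g + g') = ev g + ev g'" "ev (g * g') = ev g * ev g'" "ev (- g) = - ev g"
    "ev (smult c g) = base_emb h c * ev g" "ev 1 = 1" "ev [:c:] = base_emb h c" "ev [:0, 1:] = \<theta>" for g g' c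
    unfolding ev_def by (simp_all add: Ep.hom_add Ep.hom_mult Ep.hom_uminus E.map_poly_hom_smult E.map_poly_pCons_hom)
  have "y \<in> generate_field (class_ring :: 'l ring) (insert \<theta> (range h))" using gen by simp
  then have "\<exists>N g. N \<noteq> 0 \<and> base_emb h N * y = ev g"
  proof (induction rule: generate_field.induct)
    case one
    show ?case by (intro exI[of _ 1]) (simp add: ev)
  next
    case (incl y)
    show ?case
    proof (cases "y = \<theta>")
      case True
      then show ?thesis by (intro exI[of _ 1] exI[of _ "[:0, 1:]"]) (simp add: ev)
    next
      case False
      then obtain k where k: "y = h k" using incl by blast
      obtain a b where ab: "k = Fract a b" "b \<noteq> 0" by (cases k)
      then have "to_fract b * k = to_fract a" by (simp add: Fract_conv_to_fract)
      then have "base_emb h b * y = ev [:a:]"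
        unfolding k ev base_emb_def by (simp flip: h.hom_mult)
      then show ?thesis using ab(2) by blast
    qed
  next
    case (a_inv y)
    then obtain N g where "N \<noteq> 0" "base_emb h N * y = ev g" by blast
    then show ?case by (intro exI[of _ N] exI[of _ "- g"]) (simp add: ev class_ring_simps)
  next
    case (m_inv y)
    then have y: "y \<noteq> 0" by simp
    have inv: "inv\<^bsub>(class_ring :: 'l ring)\<^esub> y = inverse y"
      by (rule class_cring.comm_inv_char) (use y in auto)
    obtain N g where g: "N \<noteq> 0" "base_emb h N * y = ev g" using m_inv by blast
    then have "ev g \<noteq> 0" using y by (metis E.hom_0_iff mult_eq_0_iff)
    then obtain C P where C: "C \<noteq> 0" "base_emb h C = ev g * poly (map_poly (base_emb h) P) (ev g)"
      using ex_base_multiple[OF h sep] by blast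
    have "poly (map_poly (base_emb h) P) (ev g) = ev (P \<circ>\<^sub>p g)"
      unfolding ev_def by (simp add: E.map_poly_pcompose poly_pcompose)
    then have "base_emb h C * inverse y = ev (smult N (P \<circ>\<^sub>p g))"
      unfolding ev C(2) g(2)[symmetric] using y by (simp add: field_simps)
    then show ?case unfolding inv using C(1) by blast
  next
    case (eng_add y y')
    then obtain N g N' g' where g: "N \<noteq> 0" "base_emb h N * y = ev g" "N' \<noteq> 0" "base_emb h N' * y' = ev g'" by blast
    have "base_emb h (N * N') * (y + y') = base_emb h N' * (base_emb h N * y) + base_emb h N * (base_emb h N' * y')"
      by (simp add: E.hom_mult algebra_simps)
    also have "\<dots> = ev (smult N' g + smult N g')" unfolding g ev ..
    finally have "base_emb h (N * N') * (y + y') = ev (smult N' g + smult N g')" .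
    then show ?case using g(1,3) by (intro exI[of _ "N * N'"] exI) auto
  next
    case (eng_mult y y')
    then obtain N g N' g' where g: "N \<noteq> 0" "base_emb h N * y = ev g" "N' \<noteq> 0" "base_emb h N' * y' = ev g'" by blast
    have "base_emb h (N * N') * (y * y') = (base_emb h N * y) * (base_emb h N' * y')"
      by (simp add: E.hom_mult algebra_simps)
    also have "\<dots> = ev (g * g')" unfolding g ev ..
    finally have "base_emb h (N * N') * (y * y') = ev (g * g')" .
    then show ?case using g(1,3) by (intro exI[of _ "N * N'"] exI) auto
  qed
  then show ?thesis unfolding ev_def .
qed

theorem theorem5p2:
  fixes h :: "'a::idom_divide fract \<Rightarrow> 'l::field"
    and \<theta> :: 'l
    and f :: "'a poly"
    and n :: nat
  assumes "principal_domain (class_ring :: 'a ring)"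
    and "field_hom h"
    and "extension_degree h = n"
    and "n \<ge> 2"
    and "separable_extension h"
    and "\<theta> \<in> integral_closure h"
    and "generate_field (class_ring :: 'l ring) (insert \<theta> (range h)) = UNIV"
    and "degree f = n"
    and "minimal_polynomial h (map_poly to_fract f) \<theta>"
  shows "(\<forall>b. degree_one_ideal h \<theta> b \<longrightarrow>
            (\<exists>a z. a dvd poly f z \<and>
               C_mat n f a z \<in> corresponding_similarity_class h \<theta> n f (ideal_class h \<theta> b))) \<and>
         (adjoin h \<theta> = integral_closure h \<longrightarrow>
            (\<forall>S \<in> similarity_classes n f. \<exists>a z. a dvd poly f z \<and> C_mat n f a z \<in> S))"
proof -
  have deg: "degree (map_poly to_fract g) = degree g" for g :: "'a poly"
    by (rule degree_map_poly) simp
  note mp = assms(9)[unfolded minimal_polynomial_def map_poly_base_emb[OF assms(2)]]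
  have mon: "monogenic h \<theta> f n"
  proof (intro monogenic.intro pid_type.intro monogenic_axioms.intro)
    show "inj_idom_hom (base_emb h)" by (rule base_emb_hom[OF assms(2)])
    have "to_fract (lead_coeff f) = to_fract 1" using mp by (simp add: deg coeff_map_poly)
    then show "lead_coeff f = 1" by (simp only: to_fract_eq_iff)
    show "poly (map_poly (base_emb h) f) \<theta> = 0" using mp by blast
    fix g :: "'a poly" assume g: "degree g < n" "poly (map_poly (base_emb h) g) \<theta> = 0"
    show "g = 0"
    proof (rule ccontr)
      assume "g \<noteq> 0"
      then have "map_poly to_fract g \<noteq> 0" by (simp add: map_poly_eq_0_iff)
      moreover have "poly (map_poly h (map_poly to_fract g)) \<theta> = 0"
        unfolding map_poly_base_emb[OF assms(2)] by (rule g(2))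
      ultimately have "degree f \<le> degree g" using mp by (metis deg)
      then show False using g(1) assms(8) by simp
    qed
  next
    fix y show "\<exists>N g. N \<noteq> 0 \<and> base_emb h N * y = poly (map_poly (base_emb h) g) \<theta>"
      by (rule fraction_representation[OF assms(2,5,7)])
  qed (use assms in auto)
  have "\<exists>a z. a dvd poly f z \<and> C_mat n f a z \<in> S"
    if "adjoin h \<theta> = integral_closure h" "S \<in> similarity_classes n f" for S
  proof -
    interpret integrally_closed_monogenic "TYPE('a)" h \<theta> f n
      using mon that(1) by (intro integrally_closed_monogenic.intro integrally_closed_monogenic_axioms.intro)
    show ?thesis by (rule similarity_class_C_mat[OF that(2)])
  qed
  then show ?thesis using monogenic.corresponding_C_mat[OF mon] by blast
qed

end
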